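(* (A) For every positive integer $m \le 18$ and for $m \in \{20,24\}$, one has $\nu_2(K_m) = Z(m)$. (B) The asymptotic ratio between the $2$-page crossing number of $K_n$ and $Z(n)$ satisfies \[ \lim_{n\to\infty} \frac{\nu_2(K_n)}{Z(n)} \ge 0.9253 . \]
   Context: A $2$-page drawing of a graph places its vertices on a straight line (the spine), and draws each edge as a curve contained in one of the two open half-planes determined by the spine (edges meet the spine only at their endpoints). The $2$-page crossing number $\nu_2(G)$ of a graph $G$ is the minimum number of pairwise crossings of edges (at points other than vertices) over all $2$-page drawings of $G$. $K_n$ denotes the complete graph on $n$ vertices, and \[ Z(n) := \frac{1}{4}\left\lfloor \frac{n}{2}\right\rfloor \left\lfloor \frac{n-1}{2}\right\rfloor \left\lfloor \frac{n-2}{2}\right\rfloor \left\lfloor \frac{n-3}{2}\right\rfloor . \] *)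

theory Defs
  imports "HOL-Analysis.Analysis"
begin

text \<open>A graph is a pair of a vertex set and a set of edges, each edge a two-element set of vertices.\<close>

type_synonym 'a graph = "'a set \<times> 'a set set"

abbreviation verts :: "'a graph \<Rightarrow> 'a set" where "verts \<equiv> fst"

abbreviation edges :: "'a graph \<Rightarrow> 'a set set" where "edges \<equiv> snd"

definition complete_graph :: "nat \<Rightarrow> nat graph" where
  "complete_graph n = ({..<n}, {e. e \<subseteq> {..<n} \<and> card e = 2})"

text \<open>The spine is the line \<open>{x. a \<bullet> x = b}\<close>, so its two open half-planes are \<open>{x. a \<bullet> x < b}\<close> and
  \<open>{x. a \<bullet> x > b}\<close>; \<open>p\<close> places the vertices and \<open>\<gamma> e\<close> is the curve drawn for the edge \<open>e\<close>.\<close>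

definition two_page_drawing ::
    "'a graph \<Rightarrow> real^2 \<Rightarrow> real \<Rightarrow> ('a \<Rightarrow> real^2) \<Rightarrow> ('a set \<Rightarrow> real \<Rightarrow> real^2) \<Rightarrow> bool" where
  "two_page_drawing G a b p \<gamma> \<longleftrightarrow>
     a \<noteq> 0 \<and>
     inj_on p (verts G) \<and>
     (\<forall>v\<in>verts G. a \<bullet> p v = b) \<and>
     (\<forall>e\<in>edges G. arc (\<gamma> e) \<and>
        {pathstart (\<gamma> e), pathfinish (\<gamma> e)} = p ` e \<and>
        (\<gamma> e ` {0<..<1} \<subseteq> {x. a \<bullet> x < b} \<or> \<gamma> e ` {0<..<1} \<subseteq> {x. a \<bullet> x > b}))"

text \<open>Crossings are counted per unordered pair of edges and per point: two edges meeting \<open>k\<close> times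
  contribute \<open>k\<close>, and a point lying on \<open>j\<close> edges contributes \<open>j choose 2\<close>.
  Tangential contacts are counted as well; this does not affect the minimum, since drawing every
  edge as a semicircle in its half-plane leaves exactly the unavoidable proper crossings.\<close>

definition crossings ::
    "'a graph \<Rightarrow> ('a \<Rightarrow> real^2) \<Rightarrow> ('a set \<Rightarrow> real \<Rightarrow> real^2) \<Rightarrow> ('a set set \<times> (real^2)) set" where
  "crossings G p \<gamma> =
     {({e, f}, x) | e f x. e \<in> edges G \<and> f \<in> edges G \<and> e \<noteq> f \<and>
        x \<in> path_image (\<gamma> e) \<inter> path_image (\<gamma> f) - p ` verts G}"

text \<open>Drawings with infinitely many crossings are excluded, since \<^const>\<open>card\<close> would count them as \<open>0\<close>.\<close>

definition two_page_crossing_number :: "'a graph \<Rightarrow> nat" where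
  "two_page_crossing_number G =
     (LEAST k. \<exists>a b p \<gamma>. two_page_drawing G a b p \<gamma> \<and>
        finite (crossings G p \<gamma>) \<and> card (crossings G p \<gamma>) = k)"

definition Z :: "nat \<Rightarrow> real" where
  "Z n = 1/4 * of_int (\<lfloor>real n / 2\<rfloor> * \<lfloor>(real n - 1) / 2\<rfloor> * \<lfloor>(real n - 2) / 2\<rfloor> * \<lfloor>(real n - 3) / 2\<rfloor>)"

end

theory Submission
  imports Defs
begin

text \<open>The equality \<open>\<nu>\<^sub>2(K\<^sub>n) = Z(n)\<close> holds for every \<open>n\<close>, so the limit is \<open>1\<close>. List the vertices along the
  spine and colour each edge by its half-plane. Two edges of the same colour with interleaving ends
  must meet (Fashoda's theorem), and a drawing with parabolas has no other crossings, so it remains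
  to minimise the number of monochromatic interleaving pairs over all colourings. The lower bound is
  the \<open>k\<close>-edge argument of Abrego, Aichholzer, Fernandez-Merchant, Ramos and Salazar. Every edge
  splits the other vertices into a left and a right side; a four-point set has two separating edges
  if it has a crossing and three otherwise, so the crossing number is \<open>3 (n choose 4)\<close> minus the sum
  of the products of the side sizes. Edges with a small side are bounded from below by induction,
  deleting the last vertex. The upper bound is attained for even \<open>n\<close> by colouring \<open>ij\<close> according to
  whether \<open>i + j\<close> modulo \<open>n\<close> is below \<open>n / 2\<close>, and for odd \<open>n\<close> by deleting a vertex with
  at least the average number of crossings from that colouring.\<close>

section \<open>Sides of an edge\<close>

text \<open>\<open>C i j\<close>, for \<open>i < j\<close>, means that the edge \<open>ij\<close> lies in the upper half-plane. The orientation of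
  a triangle is decided by the half-plane of its longest edge; hence the side of \<open>ij\<close> on which \<open>r\<close>
  lies depends on a different edge in each of the three cases. Only used for \<open>r \<noteq> i\<close> and \<open>r \<noteq> j\<close>.\<close>

definition left_of :: "(nat \<Rightarrow> nat \<Rightarrow> bool) \<Rightarrow> nat \<Rightarrow> nat \<Rightarrow> nat \<Rightarrow> bool" where
  "left_of C i j r = (if r < i then C r j else if r < j then \<not> C i j else C i r)"

definition side :: "(nat \<Rightarrow> nat \<Rightarrow> bool) \<Rightarrow> nat \<Rightarrow> bool \<Rightarrow> nat \<Rightarrow> nat \<Rightarrow> nat set" where
  "side C n s i j = {r. r < n \<and> r \<noteq> i \<and> r \<noteq> j \<and> left_of C i j r = s}"

definition pairs :: "nat \<Rightarrow> (nat \<times> nat) set" where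
  "pairs n = {(i, j). i < j \<and> j < n}"

definition quads :: "nat \<Rightarrow> (nat \<times> nat \<times> nat \<times> nat) set" where
  "quads n = {(a, b, c, d). a < b \<and> b < c \<and> c < d \<and> d < n}"

text \<open>Of the three ways to split four points of a line into two edges only \<open>ac\<close>
  with \<open>bd\<close> interleaves, so these quadruples stand for the crossings that the colouring
  forces.\<close>

definition mono_quads :: "(nat \<Rightarrow> nat \<Rightarrow> bool) \<Rightarrow> nat \<Rightarrow> (nat \<times> nat \<times> nat \<times> nat) set" where
  "mono_quads C n = {(a, b, c, d). a < b \<and> b < c \<and> c < d \<and> d < n \<and> C a c = C b d}"

lemma card_filter_eq_sum:
  "finite A \<Longrightarrow> card {x \<in> A. P x} = (\<Sum>x\<in>A. if P x then 1 else 0)"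
  by (simp add: sum.If_cases Int_def)

lemma finite_side [simp]: "finite (side C n s i j)"
  by (rule finite_subset[of _ "{..<n}"]) (auto simp: side_def)

lemma finite_pairs [simp]: "finite (pairs n)"
  by (rule finite_subset[of _ "{..<n} \<times> {..<n}"]) (auto simp: pairs_def)

lemma finite_quads [simp]: "finite (quads n)"
  by (rule finite_subset[of _ "{..<n} \<times> {..<n} \<times> {..<n} \<times> {..<n}"]) (auto simp: quads_def)

lemma mono_quads_subset: "mono_quads C n \<subseteq> quads n"
  by (auto simp: mono_quads_def quads_def)

lemma finite_mono_quads [simp]: "finite (mono_quads C n)"
  using finite_subset[OF mono_quads_subset] by simp

lemma card_sides:
  assumes "i < j" "j < n"
  shows "card (side C n True i j) + card (side C n False i j) + 2 = n"
proof -
  have "side C n True i j \<union> side C n False i j = {..<n} - {i, j}"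
    by (auto simp: side_def)
  moreover have "side C n True i j \<inter> side C n False i j = {}"
    by (auto simp: side_def)
  ultimately have "card (side C n True i j) + card (side C n False i j) = card ({..<n} - {i, j})"
    by (metis card_Un_disjoint finite_side)
  also have "\<dots> = n - 2"
    using assms by (subst card_Diff_subset) auto
  finally show ?thesis using assms by simp
qed

lemma pairs_Suc: "pairs (Suc n) = pairs n \<union> (\<lambda>i. (i, n)) ` {..<n}"
  by (auto simp: pairs_def image_iff less_Suc_eq)

lemma sum_pairs_Suc:
  "(\<Sum>p\<in>pairs (Suc n). f p) = (\<Sum>p\<in>pairs n. f p) + (\<Sum>i<n. f (i, n) :: 'a :: comm_monoid_add)"
proof -
  have "pairs n \<inter> (\<lambda>i. (i, n)) ` {..<n} = {}" by (auto simp: pairs_def)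
  then show ?thesis unfolding pairs_Suc
    by (subst sum.union_disjoint) (auto simp: sum.reindex inj_on_def)
qed

lemma card_pairs: "2 * card (pairs n) = n * (n - 1)"
proof (induction n)
  case 0 then show ?case by (simp add: pairs_def)
next
  case (Suc n)
  have "card (pairs (Suc n)) = card (pairs n) + n"
    using sum_pairs_Suc[of "\<lambda>_. 1::nat" n] by simp
  with Suc show ?case by (cases n) (auto simp: algebra_simps)
qed

text \<open>In increasing order the indices with \<open>D\<close> receive
  \<open>0, 1, 2, ...\<close> and the others \<open>N - 1, N - 2, ...\<close>; the two runs meet
  without overlap. Counts of this form arise from the side sizes of the edges at one vertex.\<close>

lemma bij_betw_side_count:
  fixes D :: "nat \<Rightarrow> bool" and N :: nat
  defines "f \<equiv> \<lambda>i. card {r. r < i \<and> D r} + (if D i then 0 else N - 1 - i)"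
  shows "bij_betw f {..<N} {..<N}"
proof -
  define g where "g i = card {r. r < i \<and> D r}" for i
  have g_le: "g i' \<le> g i + (i' - i)" if "i \<le> i'" for i i'
  proof -
    have "g i' \<le> card ({r. r < i \<and> D r} \<union> {i..<i'})" unfolding g_def by (rule card_mono) auto
    also have "\<dots> \<le> g i + (i' - i)" unfolding g_def using card_Un_le[of "{r. r < i \<and> D r}" "{i..<i'}"] by simp
    finally show ?thesis .
  qed
  have g_Suc: "g (Suc i) = g i + (if D i then 1 else 0)" for i
  proof -
    have "{r. r < Suc i \<and> D r} = (if D i then insert i {r. r < i \<and> D r} else {r. r < i \<and> D r})"
      by (auto simp: less_Suc_eq)
    then show ?thesis by (simp add: g_def)
  qed
  have g_mono: "g i \<le> g i'" if "i \<le> i'" for i i'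
    unfolding g_def using that by (intro card_mono) auto
  have f: "f i = g i + (if D i then 0 else N - 1 - i)" for i by (simp add: f_def g_def)
  have neq: "f i \<noteq> f i'" if "i < i'" "i' < N" for i i'
    using that g_le[of "Suc i" i'] g_mono[of "Suc i" i'] g_Suc[of i] by (auto simp: f split: if_splits)
  have g0: "g 0 = 0" by (simp add: g_def)
  have inj: "inj_on f {..<N}"
    by (rule inj_onI) (metis neq lessThan_iff linorder_neqE_nat)
  have sub: "f ` {..<N} \<subseteq> {..<N}"
  proof clarsimp
    fix i assume "i < N"
    then show "f i < N" using g_le[of 0 i] g0 by (auto simp: f)
  qed
  from inj sub show ?thesis
    by (simp add: bij_betw_def endo_inj_surj)
qed

section \<open>Edges with a small side\<close>

text \<open>For \<open>K \<le> (n - 1) / 2\<close> at most one of the two truncated differences is nonzero, and this is the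
  number \<open>E\<^sub>\<le>\<^sub>\<le>\<^sub>k\<close> of the literature with \<open>k = K - 1\<close>.\<close>

definition edge_weight :: "(nat \<Rightarrow> nat \<Rightarrow> bool) \<Rightarrow> nat \<Rightarrow> nat \<Rightarrow> nat" where
  "edge_weight C n K = (\<Sum>(i, j)\<in>pairs n. \<Sum>s\<in>UNIV. K - card (side C n s i j))"

lemma sum_bool: "(\<Sum>s\<in>UNIV. f s) = f True + (f False :: 'a :: comm_monoid_add)"
  by (simp add: UNIV_bool add.commute)

text \<open>The new vertex lies beyond both ends, so the colour \<open>C i n\<close> names the side
  that it joins, and no older vertex changes sides.\<close>

lemma card_side_Suc:
  assumes "i < j" "j < n"
  shows "card (side C (Suc n) s i j) = card (side C n s i j) + (if C i n = s then 1 else 0)"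
proof -
  have "side C (Suc n) s i j = (if C i n = s then insert n (side C n s i j) else side C n s i j)"
    using assms by (auto simp: side_def left_of_def less_Suc_eq)
  moreover have "n \<notin> side C n s i j" by (simp add: side_def)
  ultimately show ?thesis by simp
qed

text \<open>A vertex before \<open>i\<close> is placed by its own edge to \<open>n\<close>, and all
  those between \<open>i\<close> and \<open>n\<close> lie together on the side
  \<open>\<not> C i n\<close>. This is the count of \<open>bij_betw_side_count\<close> with
  \<open>D r\<close> read as \<open>C r n = s\<close>.\<close>

lemma bij_betw_card_side_last:
  "bij_betw (\<lambda>i. card (side C (Suc n) s i n)) {..<n} {..<n}"
proof -
  have eq: "card (side C (Suc n) s i n) = card {r. r < i \<and> C r n = s} + (if C i n = s then 0 else n - 1 - i)"
    if "i < n" for i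
  proof -
    have "side C (Suc n) s i n = {r. r < i \<and> C r n = s} \<union> (if C i n = s then {} else {i<..<n})"
      using that by (auto simp: side_def left_of_def)
    moreover have "card ({r. r < i \<and> C r n = s} \<union> {i<..<n}) = card {r. r < i \<and> C r n = s} + (n - 1 - i)"
      by (subst card_Un_disjoint) auto
    ultimately show ?thesis by simp
  qed
  show ?thesis
    using bij_betw_side_count[of "\<lambda>r. C r n = s" n] by (rule bij_betw_cong[THEN iffD1, rotated]) (simp add: eq)
qed

lemma sum_diff_lessThan: "K \<le> n \<Longrightarrow> 2 * (\<Sum>v<n. K - v) = K * (K + 1)" for K n :: nat
proof -
  assume "K \<le> n"
  then have "(\<Sum>v<n. K - v) = (\<Sum>v<K. K - v)"
    by (intro sum.mono_neutral_right) auto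
  also have "2 * \<dots> = K * (K + 1)"
  proof (induction K)
    case (Suc K)
    have "(\<Sum>v<Suc K. Suc K - v) = (\<Sum>v<K. Suc (K - v)) + 1"
      by (auto simp: Suc_diff_le intro!: sum.cong)
    also have "\<dots> = (\<Sum>v<K. K - v) + Suc K"
      by (simp add: sum.distrib[of "\<lambda>v. K - v" "\<lambda>_. 1", simplified])
    finally show ?case using Suc by simp
  qed simp
  finally show "2 * (\<Sum>v<n. K - v) = K * (K + 1)" .
qed

text \<open>On each side the sizes are \<open>0, ..., n - 1\<close> in some order, so the edges at
  the last vertex contribute \<open>1 + ... + K\<close> twice, whatever the colouring.\<close>

lemma edge_weight_last:
  assumes "K \<le> n"
  shows "(\<Sum>i<n. \<Sum>s\<in>UNIV. K - card (side C (Suc n) s i n)) = K * (K + 1)"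
proof -
  have "(\<Sum>i<n. K - card (side C (Suc n) s i n)) = (\<Sum>v<n. K - v)" for s
    by (rule sum.reindex_bij_betw[OF bij_betw_card_side_last])
  then show ?thesis using sum_diff_lessThan[OF assms] by (simp add: sum_bool sum.distrib)
qed

text \<open>Deleting the last vertex \<open>n\<close> leaves the size of the side not containing it unchanged. Within the
  vertices beyond \<open>i\<close> these sizes form an initial segment of the naturals, and the \<open>i\<close> vertices
  before \<open>i\<close> add at most \<open>i\<close>.\<close>

lemma card_invariant_row:
  fixes C :: "nat \<Rightarrow> nat \<Rightarrow> bool"
  assumes "K + 2 \<le> n" "i \<le> K"
  defines "s \<equiv> \<not> C i n"
  shows "K + 1 - i \<le> card {j. i < j \<and> j < n \<and> card (side C n s i j) \<le> K}"
proof -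
  define N where "N = n - i - 1"
  \<comment> \<open>Indices are reversed by \<open>t = n - 1 - j\<close>: a vertex \<open>r\<close>
    beyond \<open>j\<close> is placed by \<open>C i r\<close>, so it has to come before
    \<open>t\<close> in the count.\<close>
  define D where "D = (\<lambda>t. C i (n - 1 - t) = s)"
  define f where "f t = card {r. r < t \<and> D r} + (if D t then 0 else N - 1 - t)" for t
  have bij: "bij_betw f {..<N} {..<N}"
    using bij_betw_side_count[of D N] by (simp add: f_def[abs_def])
  have le: "card (side C n s i (n - 1 - t)) \<le> f t + i" if "t < N" for t
  proof -
    define j where "j = n - 1 - t"
    have j: "i < j" "j < n" "t = n - 1 - j" using that assms(1,2) by (auto simp: N_def j_def)
    have "side C n s i j \<subseteq> {..<i} \<union> ((\<lambda>r. n - 1 - r) ` {r. r < t \<and> D r} \<union> (if D t then {} else {i<..<j}))"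
    proof
      fix r assume r: "r \<in> side C n s i j"
      consider "r < i" | "i < r" "r < j" | "j < r" "r < n" using r by (force simp: side_def)
      then show "r \<in> {..<i} \<union> ((\<lambda>r. n - 1 - r) ` {r. r < t \<and> D r} \<union> (if D t then {} else {i<..<j}))"
      proof cases
        case 3
        then have "n - 1 - r < t \<and> D (n - 1 - r)" and "r = n - 1 - (n - 1 - r)"
          using r j by (auto simp: side_def left_of_def D_def)
        then show ?thesis by blast
      qed (use r j in \<open>auto simp: side_def left_of_def D_def\<close>)
    qed
    then have "card (side C n s i j)
        \<le> card ({..<i} \<union> ((\<lambda>r. n - 1 - r) ` {r. r < t \<and> D r} \<union> (if D t then {} else {i<..<j})))"
      by (intro card_mono) auto
    also have "\<dots> \<le> i + (card ((\<lambda>r. n - 1 - r) ` {r. r < t \<and> D r}) + card (if D t then {} else {i<..<j}))"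
      by (intro order.trans[OF card_Un_le] add_mono card_Un_le) simp
    also have "\<dots> \<le> i + (card {r. r < t \<and> D r} + (if D t then 0 else N - 1 - t))"
      using j by (intro add_mono card_image_le) (auto simp: N_def)
    finally show ?thesis by (simp add: f_def j_def)
  qed
  \<comment> \<open>Values of \<open>f\<close> below \<open>K + 1 - i\<close> stay at most
    \<open>K\<close> after adding \<open>i\<close>; \<open>K + 2 \<le> n\<close> ensures that all of
    them are attained.\<close>
  define A where "A = {t. t < N \<and> f t < K + 1 - i}"
  have "f ` A = {..<K + 1 - i}"
  proof -
    have "f ` {..<N} = {..<N}" using bij by (simp add: bij_betw_def)
    moreover have "K + 1 - i \<le> N" using assms by (simp add: N_def)
    ultimately have "{..<K + 1 - i} \<subseteq> f ` {..<N}" by auto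
    then show ?thesis unfolding A_def by fastforce
  qed
  then have "K + 1 - i = card (f ` A)" by simp
  also have "\<dots> \<le> card A" by (rule card_image_le) (simp add: A_def)
  also have "\<dots> = card ((\<lambda>t. n - 1 - t) ` A)"
    by (rule card_image[symmetric]) (auto simp: inj_on_def A_def N_def)
  also have "\<dots> \<le> card {j. i < j \<and> j < n \<and> card (side C n s i j) \<le> K}"
  proof (rule card_mono)
    show "(\<lambda>t. n - 1 - t) ` A \<subseteq> {j. i < j \<and> j < n \<and> card (side C n s i j) \<le> K}"
    proof clarsimp
      fix t assume "t \<in> A"
      then show "i < n - Suc t \<and> n - Suc t < n \<and> card (side C n s i (n - Suc t)) \<le> K"
        using le[of t] assms(1,2) by (auto simp: A_def N_def)
    qed
  qed simp
  finally show ?thesis .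
qed

text \<open>The rows \<open>i = 0, ..., K\<close> give \<open>(K + 1) + K + ... + 1\<close> edges.
  The side \<open>\<not> C i n\<close> is the one that a further vertex \<open>n\<close> does not
  join, which makes these edges gain weight in \<open>edge_weight_Suc\<close>.\<close>

lemma card_invariant:
  assumes "K + 2 \<le> n"
  shows "(K + 1) * (K + 2) \<le> 2 * (\<Sum>(i, j)\<in>pairs n. if card (side C n (\<not> C i n) i j) \<le> K then 1 else 0)"
proof -
  have "(K + 1) * (K + 2) = 2 * (\<Sum>i<n. K + 1 - i)"
    using sum_diff_lessThan[of "K + 1" n] assms by simp
  also have "(\<Sum>i<n. K + 1 - i) \<le> (\<Sum>i<n. card {j. i < j \<and> j < n \<and> card (side C n (\<not> C i n) i j) \<le> K})"
  proof (rule sum_mono)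
    fix i show "K + 1 - i \<le> card {j. i < j \<and> j < n \<and> card (side C n (\<not> C i n) i j) \<le> K}"
      using card_invariant_row[OF assms, of i C] by (cases "i \<le> K") auto
  qed
  also have "\<dots> = card (SIGMA i:{..<n}. {j. i < j \<and> j < n \<and> card (side C n (\<not> C i n) i j) \<le> K})"
    by simp
  also have "(SIGMA i:{..<n}. {j. i < j \<and> j < n \<and> card (side C n (\<not> C i n) i j) \<le> K})
     = {p \<in> pairs n. case p of (i, j) \<Rightarrow> card (side C n (\<not> C i n) i j) \<le> K}"
    by (auto simp: pairs_def)
  also have "card \<dots> = (\<Sum>p\<in>pairs n. if (case p of (i, j) \<Rightarrow> card (side C n (\<not> C i n) i j) \<le> K) then 1 else 0)"
    by (rule card_filter_eq_sum[OF finite_pairs])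
  finally show ?thesis by (simp add: case_prod_unfold)
qed

text \<open>On the side that receives \<open>n\<close> the larger size cancels the larger
  \<open>K\<close>; the other side gains one exactly if its size is at most \<open>K\<close>. The
  edges ending at \<open>n\<close> contribute their fixed total.\<close>

lemma edge_weight_Suc:
  assumes "K + 1 \<le> n"
  shows "edge_weight C (Suc n) (Suc K) = edge_weight C n K + (K + 1) * (K + 2)
    + (\<Sum>(i, j)\<in>pairs n. if card (side C n (\<not> C i n) i j) \<le> K then 1 else 0)"
proof -
  have "(\<Sum>s\<in>UNIV. Suc K - card (side C (Suc n) s i j))
      = (\<Sum>s\<in>UNIV. K - card (side C n s i j)) + (if card (side C n (\<not> C i n) i j) \<le> K then 1 else 0)"
    if "(i, j) \<in> pairs n" for i j
    using that by (auto simp: sum_bool card_side_Suc pairs_def Suc_diff_le)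
  then have "(\<Sum>(i, j)\<in>pairs n. \<Sum>s\<in>UNIV. Suc K - card (side C (Suc n) s i j))
     = (\<Sum>(i, j)\<in>pairs n. (\<Sum>s\<in>UNIV. K - card (side C n s i j)) + (if card (side C n (\<not> C i n) i j) \<le> K then 1 else 0))"
    by (intro sum.cong) auto
  also have "\<dots> = edge_weight C n K + (\<Sum>(i, j)\<in>pairs n. if card (side C n (\<not> C i n) i j) \<le> K then 1 else 0)"
    by (simp add: edge_weight_def sum.distrib case_prod_unfold)
  finally show ?thesis
    using edge_weight_last[of "Suc K" n C] assms
    by (simp add: edge_weight_def sum_pairs_Suc)
qed

text \<open>The bound on the weight is \<open>3 * (K + 2 choose 3)\<close>. After doubling, an
  induction step adds \<open>2 * (K + 1) * (K + 2)\<close> from the edges at the last vertex and at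
  least \<open>(K + 1) * (K + 2)\<close> by \<open>card_invariant\<close>, together the growth of
  the left-hand side.\<close>

lemma edge_weight_ge:
  "K + 2 \<le> n \<Longrightarrow> K * (K + 1) * (K + 2) \<le> 2 * edge_weight C n K"
proof (induction K arbitrary: n)
  case (Suc K)
  then obtain m where n: "n = Suc m" and m: "K + 2 \<le> m" by (cases n) auto
  have "K * (K + 1) * (K + 2) \<le> 2 * edge_weight C m K" by (rule Suc.IH[OF m])
  moreover have "(K + 1) * (K + 2) \<le> 2 * (\<Sum>(i, j)\<in>pairs m. if card (side C m (\<not> C i m) i j) \<le> K then 1 else 0)"
    by (rule card_invariant[OF m])
  moreover have "Suc K * (Suc K + 1) * (Suc K + 2) = K * (K + 1) * (K + 2) + 3 * ((K + 1) * (K + 2))"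
    by (simp add: algebra_simps)
  ultimately show ?case unfolding n
    using edge_weight_Suc[of K m C] m by linarith
qed simp

section \<open>Separations and crossings\<close>

definition separated :: "(nat \<Rightarrow> nat \<Rightarrow> bool) \<Rightarrow> nat \<Rightarrow> nat \<times> nat \<Rightarrow> (nat \<times> nat) set" where
  "separated C n = (\<lambda>(i, j). {(x, y). x < y \<and> y < n \<and> x \<noteq> i \<and> x \<noteq> j \<and> y \<noteq> i \<and> y \<noteq> j
     \<and> left_of C i j x \<noteq> left_of C i j y})"

definition separations :: "(nat \<Rightarrow> nat \<Rightarrow> bool) \<Rightarrow> nat \<Rightarrow> ((nat \<times> nat) \<times> nat \<times> nat) set" where
  "separations C n = Sigma (pairs n) (separated C n)"

lemma finite_separated [simp]: "finite (separated C n p)"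
  by (rule finite_subset[of _ "{..<n} \<times> {..<n}"]) (auto simp: separated_def split: prod.splits)

text \<open>Sorting by \<open>min\<close> and \<open>max\<close> identifies a choice of one vertex
  from each side with a separated pair \<open>x < y\<close>.\<close>

lemma card_separated:
  "card (separated C n (i, j)) = card (side C n True i j) * card (side C n False i j)"
proof -
  have "bij_betw (\<lambda>(x, y). (min x y, max x y)) (side C n True i j \<times> side C n False i j) (separated C n (i, j))"
    unfolding bij_betw_def
  proof (intro conjI set_eqI iffI)
    show "inj_on (\<lambda>(x, y). (min x y, max x y)) (side C n True i j \<times> side C n False i j)"
      by (auto simp: inj_on_def side_def min_def max_def split: if_splits)
  next
    fix p assume "p \<in> (\<lambda>(x, y). (min x y, max x y)) ` (side C n True i j \<times> side C n False i j)"
    then obtain x y where "p = (min x y, max x y)" "x \<in> side C n True i j" "y \<in> side C n False i j" by auto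
    then show "p \<in> separated C n (i, j)"
      by (cases x y rule: linorder_cases) (auto simp: side_def separated_def)
  next
    fix p assume p: "p \<in> separated C n (i, j)"
    obtain x y where xy: "p = (x, y)" by (cases p)
    show "p \<in> (\<lambda>(x, y). (min x y, max x y)) ` (side C n True i j \<times> side C n False i j)"
      using p by (intro image_eqI[of _ _ "if left_of C i j x then (x, y) else (y, x)"])
        (auto simp: xy side_def separated_def)
  qed
  from bij_betw_same_card[OF this] show ?thesis by (simp add: card_cartesian_product)
qed

lemma card_separations:
  "card (separations C n) = (\<Sum>(i, j)\<in>pairs n. card (side C n True i j) * card (side C n False i j))"
  unfolding separations_def by (subst card_SigmaI) (auto simp: card_separated intro!: sum.cong)

text \<open>A common shape for the five kinds of separation. Every \<open>g\<close> used is
  injective, so each cardinality becomes a sum of indicators over the same set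
  \<open>quads n\<close>.\<close>

definition quad_image ::
    "nat \<Rightarrow> (nat \<Rightarrow> nat \<Rightarrow> nat \<Rightarrow> nat \<Rightarrow> 'a) \<Rightarrow> (nat \<Rightarrow> nat \<Rightarrow> nat \<Rightarrow> nat \<Rightarrow> bool) \<Rightarrow> 'a set" where
  "quad_image n g P = (\<lambda>(a, b, c, d). g a b c d) ` {(a, b, c, d). (a, b, c, d) \<in> quads n \<and> P a b c d}"

text \<open>Of the six edges of a four-point set \<open>a < b < c < d\<close>, the edge \<open>ad\<close> never separates the other
  two points, and the remaining five give the five images below.\<close>

lemma separations_eq:
  "separations C n =
      quad_image n (\<lambda>a b c d. ((a, b), (c, d))) (\<lambda>a b c d. C a c \<noteq> C a d)
    \<union> (quad_image n (\<lambda>a b c d. ((a, c), (b, d))) (\<lambda>a b c d. C a c = C a d)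
    \<union> (quad_image n (\<lambda>a b c d. ((b, c), (a, d))) (\<lambda>a b c d. C a c \<noteq> C b d)
    \<union> (quad_image n (\<lambda>a b c d. ((b, d), (a, c))) (\<lambda>a b c d. C a d = C b d)
    \<union> quad_image n (\<lambda>a b c d. ((c, d), (a, b))) (\<lambda>a b c d. C a d \<noteq> C b d))))" (is "?L = ?A \<union> (?B \<union> (?D \<union> (?E \<union> ?G)))")
proof (intro equalityI subsetI)
  fix p assume p: "p \<in> ?L"
  obtain i j x y where pe: "p = ((i, j), (x, y))" by (metis surj_pair)
  have ord: "i < j" "j < n" "x < y" "y < n" "x \<noteq> i" "x \<noteq> j" "y \<noteq> i" "y \<noteq> j"
    and sep: "left_of C i j x \<noteq> left_of C i j y"
    using p by (auto simp: pe separations_def separated_def pairs_def)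
  consider "j < x" | "i < x" "x < j" "j < y" | "i < x" "y < j" | "x < i" "i < y" "y < j"
    | "x < i" "j < y" | "y < i" using ord by linarith
  then show "p \<in> ?A \<union> (?B \<union> (?D \<union> (?E \<union> ?G)))"
  proof cases
    case 1 then have "p \<in> ?A" using ord sep by (auto simp: quad_image_def pe quads_def left_of_def image_iff)
    then show ?thesis by blast
  next
    case 2 then have "p \<in> ?B" using ord sep by (auto simp: quad_image_def pe quads_def left_of_def image_iff)
    then show ?thesis by blast
  next
    case 3 then show ?thesis using ord sep by (auto simp: left_of_def)
  next
    case 4 then have "p \<in> ?E" using ord sep by (auto simp: quad_image_def pe quads_def left_of_def image_iff)
    then show ?thesis by blast
  next
    case 5 then have "p \<in> ?D" using ord sep by (auto simp: quad_image_def pe quads_def left_of_def image_iff)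
    then show ?thesis by blast
  next
    case 6 then have "p \<in> ?G" using ord sep by (auto simp: quad_image_def pe quads_def left_of_def image_iff)
    then show ?thesis by blast
  qed
next
  fix p assume "p \<in> ?A \<union> (?B \<union> (?D \<union> (?E \<union> ?G)))"
  then show "p \<in> ?L"
    by (elim UnE) (auto simp: quad_image_def separations_def separated_def pairs_def quads_def left_of_def)
qed

text \<open>The five conditions of \<open>separations_eq\<close> together with
  \<open>C a c = C b d\<close> form three complementary pairs, so every quadruple contributes
  exactly 3.\<close>

lemma card_separations_quads:
  "card (separations C n) + card (mono_quads C n) = 3 * card (quads n)"
proof -
  let ?Q = "\<lambda>P. {(a, b, c, d). (a, b, c, d) \<in> quads n \<and> P a b c d}"
  have finQ: "finite (?Q P)" for P by (rule finite_subset[OF _ finite_quads[of n]]) auto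
  have fin: "finite (quad_image n g P)" for g P unfolding quad_image_def by (intro finite_imageI finQ)
  have cardQ: "card (?Q P) = (\<Sum>(a, b, c, d)\<in>quads n. if P a b c d then 1 else 0)" for P
  proof -
    have "?Q P = {q \<in> quads n. case q of (a, b, c, d) \<Rightarrow> P a b c d}" by auto
    then have "card (?Q P) = (\<Sum>q\<in>quads n. if (case q of (a, b, c, d) \<Rightarrow> P a b c d) then 1 else 0)"
      by (simp only: card_filter_eq_sum[OF finite_quads])
    then show ?thesis by (simp add: case_prod_unfold)
  qed
  have cardF: "card (quad_image n g P) = (\<Sum>(a, b, c, d)\<in>quads n. if P a b c d then 1 else 0)"
    if "inj (\<lambda>(a, b, c, d). g a b c d)" for g P
    unfolding quad_image_def cardQ[symmetric] by (rule card_image) (rule inj_on_subset[OF that subset_UNIV])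
  \<comment> \<open>The five images are disjoint because the order of the four coordinates shows
    which of the sorted points form the first pair.\<close>
  have "card (separations C n) =
      card (quad_image n (\<lambda>a b c d. ((a, b), (c, d))) (\<lambda>a b c d. C a c \<noteq> C a d))
    + (card (quad_image n (\<lambda>a b c d. ((a, c), (b, d))) (\<lambda>a b c d. C a c = C a d))
    + (card (quad_image n (\<lambda>a b c d. ((b, c), (a, d))) (\<lambda>a b c d. C a c \<noteq> C b d))
    + (card (quad_image n (\<lambda>a b c d. ((b, d), (a, c))) (\<lambda>a b c d. C a d = C b d))
    + card (quad_image n (\<lambda>a b c d. ((c, d), (a, b))) (\<lambda>a b c d. C a d \<noteq> C b d)))))"
    unfolding separations_eq
    apply (subst card_Un_disjoint)
       apply (intro fin)
      apply (intro finite_UnI fin)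
     apply (fastforce simp: quad_image_def quads_def)
    apply (subst card_Un_disjoint)
       apply (intro fin)
      apply (intro finite_UnI fin)
     apply (fastforce simp: quad_image_def quads_def)
    apply (subst card_Un_disjoint)
       apply (intro fin)
      apply (intro finite_UnI fin)
     apply (fastforce simp: quad_image_def quads_def)
    apply (subst card_Un_disjoint)
       apply (intro fin)
      apply (intro finite_UnI fin)
     apply (fastforce simp: quad_image_def quads_def)
    by (rule refl)
  moreover have "mono_quads C n = ?Q (\<lambda>a b c d. C a c = C b d)"
    by (auto simp: mono_quads_def quads_def)
  then have "card (mono_quads C n) = (\<Sum>(a, b, c, d)\<in>quads n. if C a c = C b d then 1 else 0)"
    using cardQ by simp
  moreover have "3 * card (quads n) = (\<Sum>(a, b, c, d)\<in>quads n. 3)" by simp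
  moreover have "(\<Sum>(a, b, c, d)\<in>quads n. 3) = (\<Sum>(a, b, c, d)\<in>quads n.
      (if C a c \<noteq> C a d then 1 else 0) + ((if C a c = C a d then 1 else 0) + ((if C a c \<noteq> C b d then 1 else 0)
    + ((if C a d = C b d then 1 else 0) + ((if C a d \<noteq> C b d then 1 else 0) + (if C a c = C b d then 1 else (0::nat)))))))"
    by (intro sum.cong) auto
  ultimately show ?thesis
    by (simp add: cardF inj_def sum.distrib case_prod_unfold)
qed

lemma inj_on_quads: "inj_on (\<lambda>(a, b, c, d). {a, b, c, d}) (quads n)"
proof (rule inj_onI)
  fix p q assume pq: "p \<in> quads n" "q \<in> quads n"
    and eq: "(case p of (a, b, c, d) \<Rightarrow> {a, b, c, d}) = (case q of (a, b, c, d) \<Rightarrow> {a, b, c, d})"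
  from eq have "sorted_list_of_set (case p of (a, b, c, d) \<Rightarrow> {a, b, c, d})
      = sorted_list_of_set (case q of (a, b, c, d) \<Rightarrow> {a, b, c, d})" by simp
  then show "p = q" using pq by (auto simp: quads_def)
qed

lemma card_quads: "24 * real (card (quads n)) = real n * (real n - 1) * (real n - 2) * (real n - 3)"
proof -
  have "bij_betw (\<lambda>(a, b, c, d). {a, b, c, d}) (quads n) {B. B \<subseteq> {..<n} \<and> card B = 4}"
    unfolding bij_betw_def
  proof (intro conjI set_eqI iffI)
    show "inj_on (\<lambda>(a, b, c, d). {a, b, c, d}) (quads n)" by (rule inj_on_quads)
  next
    fix B assume "B \<in> (\<lambda>(a, b, c, d). {a, b, c, d}) ` quads n"
    then show "B \<in> {B. B \<subseteq> {..<n} \<and> card B = 4}" by (auto simp: quads_def)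
  next
    fix B :: "nat set" assume B: "B \<in> {B. B \<subseteq> {..<n} \<and> card B = 4}"
    then have fin: "finite B" by (auto intro: finite_subset)
    then have len: "length (sorted_list_of_set B) = 4" using B by simp
    have "\<exists>a b c d. xs = [a, b, c, d]" if "length xs = 4" for xs :: "nat list"
      using that by (auto simp: numeral_eq_Suc length_Suc_conv)
    from this[OF len] obtain a b c d where l: "sorted_list_of_set B = [a, b, c, d]" by blast
    have "sorted_wrt (<) (sorted_list_of_set B)" by (rule strict_sorted_list_of_set)
    then have "a < b" "b < c" "c < d" by (auto simp: l)
    moreover have Beq: "B = {a, b, c, d}" using set_sorted_list_of_set[OF fin] by (simp add: l)
    then have "d < n" using B by auto
    ultimately have "(a, b, c, d) \<in> quads n" by (simp add: quads_def)
    then show "B \<in> (\<lambda>(a, b, c, d). {a, b, c, d}) ` quads n"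
      by (rule rev_image_eqI) (simp add: Beq)
  qed
  from bij_betw_same_card[OF this] have "card (quads n) = n choose 4"
    by (simp add: n_subsets)
  moreover have "real (n choose 4) = (\<Prod>i<4. real n - real i) / fact 4"
    by (simp add: binomial_gbinomial gbinomial_prod_rev atLeast0LessThan)
  ultimately show ?thesis by (simp add: numeral_eq_Suc fact_numeral)
qed

section \<open>The lower bound for colourings\<close>

text \<open>The shifts in \<open>2 * q + 3\<close> and \<open>2 * q + 2\<close> make
  \<open>q\<close> the largest possible size of the smaller side of an edge: the other vertices
  number \<open>2 * q + 1\<close> and \<open>2 * q\<close>.\<close>

lemma Z_odd: "Z (2 * q + 3) = (real q)\<^sup>2 * (real q + 1)\<^sup>2 / 4"
proof -
  have "\<lfloor>real (2 * q + 3) / 2\<rfloor> = int q + 1" "\<lfloor>(real (2 * q + 3) - 1) / 2\<rfloor> = int q + 1"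
    "\<lfloor>(real (2 * q + 3) - 2) / 2\<rfloor> = int q" "\<lfloor>(real (2 * q + 3) - 3) / 2\<rfloor> = int q"
    by (auto simp: floor_eq_iff)
  then show ?thesis by (simp add: Z_def power2_eq_square)
qed

lemma Z_even: "Z (2 * q + 2) = (real q + 1) * (real q)\<^sup>2 * (real q - 1) / 4"
proof -
  have "\<lfloor>real (2 * q + 2) / 2\<rfloor> = int q + 1" "\<lfloor>(real (2 * q + 2) - 1) / 2\<rfloor> = int q"
    "\<lfloor>(real (2 * q + 2) - 2) / 2\<rfloor> = int q" "\<lfloor>(real (2 * q + 2) - 3) / 2\<rfloor> = int q - 1"
    by (auto simp: floor_eq_iff)
  then show ?thesis by (simp add: Z_def power2_eq_square)
qed

lemma nat_parity_cases:
  obtains "n \<le> 1" | q where "n = 2 * q + 2" | q where "n = 2 * q + (3 :: nat)"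
proof (cases "n \<le> 1")
  case False
  show ?thesis
  proof (cases "even n")
    case True
    then have "n = 2 * (n div 2 - 1) + 2" using False by auto
    then show ?thesis by (rule that(2))
  next
    case odd: False
    then have "n = 2 * (n div 2 - 1) + 3" using False by presburger
    then show ?thesis by (rule that(3))
  qed
qed (rule that(1))

lemma Z_le_1: "n \<le> 1 \<Longrightarrow> Z n = 0"
  by (cases n) (auto simp: Z_def)

lemma real_card_pairs: "2 * real (card (pairs n)) = real n * (real n - 1)"
  using arg_cong[OF card_pairs[of n], of real] by (cases n) (auto simp: algebra_simps)

section \<open>Products of side sizes as sums of truncated differences\<close>

lemma sum_truncated_diff: "2 * (\<Sum>K\<le>q. K - L) = (q - L) * (q - L + 1)" for q L :: nat
proof (induction q)
  case (Suc q)
  then show ?case by (cases "L \<le> q") (auto simp: Suc_diff_le algebra_simps not_le)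
qed simp

text \<open>With \<open>L = q - t\<close> and \<open>R = q + t + 1\<close> the product is
  \<open>t * (t + 1)\<close> short of \<open>q * (q + 1)\<close>. The differences at
  \<open>L\<close> add up to just that, and those at \<open>R\<close> vanish. Summed over the edges,
  the differences become edge weights.\<close>

lemma product_odd_aux:
  fixes q L R :: nat
  assumes "L + R = 2 * q + 1" "L \<le> R"
  shows "L * R + (\<Sum>K\<le>q. 2 * ((K - L) + (K - R))) = q * (q + 1)"
proof -
  have "L \<le> q" using assms by simp
  then obtain t where q: "q = L + t" using le_Suc_ex by blast
  have R: "R = L + 2 * t + 1" using assms q by simp
  show ?thesis
    by (simp only: sum_distrib_left[symmetric] sum.distrib distrib_left sum_truncated_diff)
      (simp add: q R algebra_simps)
qed

lemma product_odd:
  fixes q L R :: nat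
  assumes "L + R = 2 * q + 1"
  shows "L * R + (\<Sum>K\<le>q. 2 * ((K - L) + (K - R))) = q * (q + 1)"
  using product_odd_aux[of L R q] product_odd_aux[of R L q] assms
  by (cases "L \<le> R") (auto simp: ac_simps)

text \<open>Here \<open>L = q - t\<close> and \<open>R = q + t\<close>, so the product is only
  \<open>t^2\<close> short of \<open>q * q\<close> while the differences still give
  \<open>t * (t + 1)\<close>; the surplus \<open>t\<close> is the last summand on the right.\<close>

lemma product_even_aux:
  fixes q L R :: nat
  assumes "L + R = 2 * q" "L \<le> R"
  shows "L * R + (\<Sum>K\<le>q. 2 * ((K - L) + (K - R))) = q * q + ((q - L) + (q - R))"
proof -
  have "L \<le> q" using assms by simp
  then obtain t where q: "q = L + t" using le_Suc_ex by blast
  have R: "R = L + 2 * t" using assms q by simp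
  show ?thesis
    by (simp only: sum_distrib_left[symmetric] sum.distrib distrib_left sum_truncated_diff)
      (simp add: q R algebra_simps)
qed

lemma product_even:
  fixes q L R :: nat
  assumes "L + R = 2 * q"
  shows "L * R + (\<Sum>K\<le>q. 2 * ((K - L) + (K - R))) = q * q + ((q - L) + (q - R))"
  using product_even_aux[of L R q] product_even_aux[of R L q] assms
  by (cases "L \<le> R") (auto simp: ac_simps)

lemma sum_edge_weight:
  "(\<Sum>K\<le>q. 2 * edge_weight C n K)
    = (\<Sum>(i, j)\<in>pairs n. \<Sum>K\<le>q. 2 * ((K - card (side C n True i j)) + (K - card (side C n False i j))))"
  unfolding edge_weight_def sum_bool sum_distrib_left case_prod_unfold by (rule sum.swap)

lemma card_separations_odd:
  assumes "n = 2 * q + 3"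
  shows "card (separations C n) + (\<Sum>K\<le>q. 2 * edge_weight C n K) = card (pairs n) * (q * (q + 1))"
proof -
  have "card (separations C n) + (\<Sum>K\<le>q. 2 * edge_weight C n K)
     = (\<Sum>(i, j)\<in>pairs n. card (side C n True i j) * card (side C n False i j)
        + (\<Sum>K\<le>q. 2 * ((K - card (side C n True i j)) + (K - card (side C n False i j)))))"
    by (simp only: card_separations sum_edge_weight sum.distrib[symmetric] case_prod_unfold)
  also have "\<dots> = (\<Sum>(i, j)\<in>pairs n. q * (q + 1))"
  proof (intro sum.cong refl, clarify)
    fix i j assume "(i, j) \<in> pairs n"
    then have "card (side C n True i j) + card (side C n False i j) = 2 * q + 1"
      using card_sides[of i j n C] assms by (simp add: pairs_def)
    then show "card (side C n True i j) * card (side C n False i j)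
        + (\<Sum>K\<le>q. 2 * ((K - card (side C n True i j)) + (K - card (side C n False i j)))) = q * (q + 1)"
      by (rule product_odd)
  qed
  finally show ?thesis by simp
qed

lemma card_separations_even:
  assumes "n = 2 * q + 2"
  shows "card (separations C n) + (\<Sum>K\<le>q. 2 * edge_weight C n K)
    = card (pairs n) * (q * q) + edge_weight C n q"
proof -
  have "card (separations C n) + (\<Sum>K\<le>q. 2 * edge_weight C n K)
     = (\<Sum>(i, j)\<in>pairs n. card (side C n True i j) * card (side C n False i j)
        + (\<Sum>K\<le>q. 2 * ((K - card (side C n True i j)) + (K - card (side C n False i j)))))"
    by (simp only: card_separations sum_edge_weight sum.distrib[symmetric] case_prod_unfold)
  also have "\<dots> = (\<Sum>(i, j)\<in>pairs n. q * q + ((q - card (side C n True i j)) + (q - card (side C n False i j))))"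
  proof (intro sum.cong refl, clarify)
    fix i j assume "(i, j) \<in> pairs n"
    then have "card (side C n True i j) + card (side C n False i j) = 2 * q"
      using card_sides[of i j n C] assms by (simp add: pairs_def)
    then show "card (side C n True i j) * card (side C n False i j)
        + (\<Sum>K\<le>q. 2 * ((K - card (side C n True i j)) + (K - card (side C n False i j))))
      = q * q + ((q - card (side C n True i j)) + (q - card (side C n False i j)))"
      by (rule product_even)
  qed
  also have "\<dots> = card (pairs n) * (q * q) + edge_weight C n q"
    by (simp add: sum.distrib case_prod_unfold edge_weight_def sum_bool)
  finally show ?thesis .
qed

text \<open>The bounds of \<open>edge_weight_ge\<close> telescope:
  \<open>4 * K * (K + 1) * (K + 2)\<close> is the increment of the left-hand side from
  \<open>q = K - 1\<close> to \<open>q = K\<close>.\<close>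

lemma sum_edge_weight_ge:
  assumes "q + 2 \<le> n"
  shows "real q * (real q + 1) * (real q + 2) * (real q + 3) \<le> 4 * real (\<Sum>K\<le>q. 2 * edge_weight C n K)"
proof -
  have "real q * (real q + 1) * (real q + 2) * (real q + 3) = 4 * real (\<Sum>K\<le>q. K * (K + 1) * (K + 2))"
  proof (induction q)
    case (Suc q)
    have "4 * real (\<Sum>K\<le>Suc q. K * (K + 1) * (K + 2))
        = 4 * real (\<Sum>K\<le>q. K * (K + 1) * (K + 2)) + 4 * real (Suc q * (Suc q + 1) * (Suc q + 2))"
      by (simp only: sum.atMost_Suc of_nat_add distrib_left)
    with Suc show ?case by (simp add: algebra_simps)
  qed simp
  also have "(\<Sum>K\<le>q. K * (K + 1) * (K + 2)) \<le> (\<Sum>K\<le>q. 2 * edge_weight C n K)"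
    using assms by (intro sum_mono edge_weight_ge) auto
  finally show ?thesis by simp
qed

lemma mono_quads_ge: "Z n \<le> real (card (mono_quads C n))"
proof (cases n rule: nat_parity_cases)
  case 1
  then show ?thesis by (simp add: Z_le_1)
next
  case (2 q)
  define S where "S = real (card (separations C n))"
  define M where "M = real (card (mono_quads C n))"
  define P where "P = real (card (pairs n))"
  define Q where "Q = real (card (quads n))"
  \<comment> \<open>The top term \<open>K = q\<close> is split off. In
    \<open>card_separations_even\<close> it occurs with factor 2 on the left and 1 on the right, so
    a single \<open>V\<close> remains.\<close>
  define W where "W = real (\<Sum>K<q. 2 * edge_weight C n K)"
  define V where "V = real (edge_weight C n q)"
  have "real (card (separations C n) + (\<Sum>K\<le>q. 2 * edge_weight C n K)) = real (card (pairs n) * (q * q) + edge_weight C n q)"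
    by (simp only: card_separations_even[OF 2])
  then have 1: "S + W + V = P * (real q * real q)"
    unfolding S_def W_def V_def P_def lessThan_Suc_atMost[symmetric] by simp
  have 22: "S + M = 3 * Q" unfolding S_def M_def Q_def using card_separations_quads[of C n] by linarith
  have 3: "24 * Q = (2 * real q + 2) * (2 * real q + 1) * (2 * real q) * (2 * real q - 1)"
    unfolding Q_def card_quads 2 by (simp add: algebra_simps)
  have 4: "2 * P = (2 * real q + 2) * (2 * real q + 1)"
    unfolding P_def real_card_pairs 2 by (simp add: ac_simps)
  have "real (q * (q + 1) * (q + 2)) \<le> real (2 * edge_weight C n q)"
    using edge_weight_ge[of q n C] 2 by (intro of_nat_mono) simp
  then have 5: "real q * (real q + 1) * (real q + 2) \<le> 2 * V" unfolding V_def by (simp add: algebra_simps)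
  \<comment> \<open>The sum over \<open>K < q\<close> is bounded with \<open>q - 1\<close> in place
    of \<open>q\<close>; for \<open>q = 0\<close> both sides are zero.\<close>
  have 6: "(real q - 1) * real q * (real q + 1) * (real q + 2) \<le> 4 * W"
  proof (cases q)
    case (Suc p)
    then show ?thesis using sum_edge_weight_ge[of p n C] 2
      unfolding W_def Suc lessThan_Suc_atMost by (simp add: algebra_simps)
  qed (simp add: W_def)
  have "4 * M = 12 * Q - 4 * (P * (real q * real q)) + 4 * W + 4 * V" using 1 22 by linarith
  also have "\<dots> \<ge> 12 * Q - 4 * (P * (real q * real q)) + (real q - 1) * real q * (real q + 1) * (real q + 2)
      + 2 * (real q * (real q + 1) * (real q + 2))" using 5 6 by linarith
  also have "12 * Q = (2 * real q + 2) * (2 * real q + 1) * (2 * real q) * (2 * real q - 1) / 2" using 3 by linarith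
  also have "4 * (P * (real q * real q)) = 2 * (2 * P) * (real q * real q)" by simp
  also have "2 * P = (2 * real q + 2) * (2 * real q + 1)" by (rule 4)
  finally have "4 * M \<ge> (real q + 1) * (real q)\<^sup>2 * (real q - 1)"
    by (simp add: field_simps power2_eq_square)
  then show ?thesis unfolding M_def[symmetric] unfolding 2 Z_even by simp
next
  case (3 q)
  define S where "S = real (card (separations C n))"
  define M where "M = real (card (mono_quads C n))"
  define P where "P = real (card (pairs n))"
  define Q where "Q = real (card (quads n))"
  define W where "W = real (\<Sum>K\<le>q. 2 * edge_weight C n K)"
  have "real (card (separations C n) + (\<Sum>K\<le>q. 2 * edge_weight C n K)) = real (card (pairs n) * (q * (q + 1)))"
    by (simp only: card_separations_odd[OF 3])
  then have 1: "S + W = P * (real q * (real q + 1))"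
    unfolding S_def W_def P_def by (simp add: distrib_left)
  have 2: "S + M = 3 * Q" unfolding S_def M_def Q_def using card_separations_quads[of C n] by linarith
  have 33: "24 * Q = (2 * real q + 3) * (2 * real q + 2) * (2 * real q + 1) * (2 * real q)"
    unfolding Q_def card_quads 3 by (simp add: algebra_simps)
  have 4: "2 * P = (2 * real q + 3) * (2 * real q + 2)"
    unfolding P_def real_card_pairs 3 by simp
  have 5: "real q * (real q + 1) * (real q + 2) * (real q + 3) \<le> 4 * W"
    unfolding W_def using sum_edge_weight_ge[of q n C] 3 by simp
  have "4 * M = 12 * Q - 4 * (P * (real q * (real q + 1))) + 4 * W" using 1 2 by linarith
  also have "\<dots> \<ge> 12 * Q - 4 * (P * (real q * (real q + 1))) + real q * (real q + 1) * (real q + 2) * (real q + 3)"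
    using 5 by linarith
  also have "12 * Q = (2 * real q + 3) * (2 * real q + 2) * (2 * real q + 1) * (2 * real q) / 2" using 33 by linarith
  also have "4 * (P * (real q * (real q + 1))) = 2 * (2 * P) * (real q * (real q + 1))" by simp
  also have "2 * P = (2 * real q + 3) * (2 * real q + 2)" by (rule 4)
  finally have "4 * M \<ge> (real q)\<^sup>2 * (real q + 1)\<^sup>2"
    by (simp add: field_simps power2_eq_square)
  then show ?thesis unfolding M_def[symmetric] unfolding 3 Z_odd by simp
qed

section \<open>Optimal colourings\<close>

text \<open>In a regular polygon with \<open>2 * k\<close> corners, edges with equal
  \<open>i + j\<close> modulo \<open>2 * k\<close> are parallel; each page receives \<open>k\<close>
  consecutive directions. The modulus is unfolded, as \<open>i + j < 4 * k\<close>.\<close>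

definition zigzag :: "nat \<Rightarrow> nat \<Rightarrow> nat \<Rightarrow> bool" where
  "zigzag k i j \<longleftrightarrow> i + j < k \<or> 2 * k \<le> i + j \<and> i + j < 3 * k"

text \<open>The distance of the two side sizes of an edge from their mean \<open>k - 1\<close>; the last two
  branches rely on truncated subtraction.\<close>

definition defect :: "nat \<Rightarrow> nat \<Rightarrow> nat \<Rightarrow> nat" where
  "defect k i j = (if i + j < k \<or> 3 * k \<le> i + j then j - i else if i + j < 2 * k then j - k else k - i)"

text \<open>In each range of \<open>i + j\<close> one side is a union of explicit intervals and has
  at most half of the other vertices. Which side it is depends on the range, hence the existential
  form.\<close>

lemma card_side_zigzag:
  assumes ij: "i < j" "j < 2 * k"
  obtains s where "card (side (zigzag k) (2 * k) s i j) + defect k i j + 1 = k"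
proof -
  consider (A) "i + j < k" | (B) "k \<le> i + j" "i + j < 2 * k" | (D) "2 * k \<le> i + j" "i + j < 3 * k" | (E) "3 * k \<le> i + j"
    by linarith
  then show thesis
  proof cases
    case A
    have "side (zigzag k) (2 * k) True i j = {..<i} \<union> ({j<..<k - i} \<union> {2 * k - i..<2 * k})"
      using A ij by (auto simp: side_def left_of_def zigzag_def)
    also have "card \<dots> = i + ((k - i - j - 1) + i)"
      using A ij by (subst card_Un_disjoint; (subst card_Un_disjoint)?) auto
    finally show thesis using A ij by (intro that[of True]) (simp add: defect_def)
  next
    case B
    have "side (zigzag k) (2 * k) False i j = {k - j..<i} \<union> {j<..<2 * k - i}"
      using B ij by (auto simp: side_def left_of_def zigzag_def)
    also have "card \<dots> = (i - (k - j)) + (2 * k - i - j - 1)"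
      using B ij by (subst card_Un_disjoint) auto
    finally show thesis using B ij by (intro that[of False]) (simp add: defect_def)
  next
    case D
    \<comment> \<open>The bound \<open>3 * k - i\<close> exceeds the vertex range if
      \<open>i < k\<close>; this is where a positive defect \<open>k - i\<close> arises.\<close>
    have "side (zigzag k) (2 * k) True i j = {2 * k - j..<i} \<union> {j<..<min (2 * k) (3 * k - i)}"
      using D ij by (auto simp: side_def left_of_def zigzag_def)
    also have "card \<dots> = (i - (2 * k - j)) + (min (2 * k) (3 * k - i) - j - 1)"
      using D ij by (subst card_Un_disjoint) auto
    finally show thesis using D ij by (intro that[of True]) (auto simp: defect_def min_def)
  next
    case E
    have "side (zigzag k) (2 * k) False i j = {..<2 * k - j} \<union> ({3 * k - j..<i} \<union> {j<..<2 * k})"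
      using E ij by (auto simp: side_def left_of_def zigzag_def)
    also have "card \<dots> = (2 * k - j) + ((i - (3 * k - j)) + (2 * k - j - 1))"
      using E ij by (subst card_Un_disjoint; (subst card_Un_disjoint)?) auto
    finally show thesis using E ij by (intro that[of False]) (simp add: defect_def)
  qed
qed

text \<open>The sides have sizes \<open>k - 1 - d\<close> and \<open>k - 1 + d\<close> for the
  defect \<open>d\<close>, so this is a difference of squares.\<close>

lemma sides_zigzag:
  assumes ij: "i < j" "j < 2 * k"
  shows "card (side (zigzag k) (2 * k) True i j) * card (side (zigzag k) (2 * k) False i j) + (defect k i j)\<^sup>2 = (k - 1)\<^sup>2"
proof -
  have *: "L * R + d\<^sup>2 = (k - 1)\<^sup>2" if "L + R + 2 = 2 * k" "L + d + 1 = k" for L R d :: nat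
  proof -
    have "k = L + d + 1" "R = L + 2 * d" using that by auto
    then show ?thesis by (simp add: power2_eq_square algebra_simps)
  qed
  have "card (side (zigzag k) (2 * k) True i j) + card (side (zigzag k) (2 * k) False i j) + 2 = 2 * k"
    by (rule card_sides[OF ij])
  moreover obtain s where "card (side (zigzag k) (2 * k) s i j) + defect k i j + 1 = k"
    by (rule card_side_zigzag[OF ij])
  ultimately show ?thesis
    using *[of "card (side (zigzag k) (2 * k) True i j)" "card (side (zigzag k) (2 * k) False i j)"]
      *[of "card (side (zigzag k) (2 * k) False i j)" "card (side (zigzag k) (2 * k) True i j)"]
    by (cases s) (auto simp: ac_simps)
qed

text \<open>Row \<open>d\<close> of the triangle has \<open>k - d\<close> points. Keeping
  \<open>k^2\<close> on the left avoids a truncated subtraction in the closed form.\<close>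

lemma sum_triangle_squares:
  "12 * (\<Sum>(d, e)\<in>{(d, e). d + e < k}. d\<^sup>2) + k\<^sup>2 = k ^ 4" for k :: nat
proof -
  have "12 * (\<Sum>d<k. real (k - d) * (real d)\<^sup>2) + (real k)\<^sup>2 = real k ^ 4"
  proof (induction k)
    case (Suc k)
    have sq: "6 * (\<Sum>d<k. (real d)\<^sup>2) = (real k - 1) * real k * (2 * real k - 1)" for k
      by (induction k) (auto simp: algebra_simps power2_eq_square)
    have "(\<Sum>d<Suc k. real (Suc k - d) * (real d)\<^sup>2) = (\<Sum>d<k. real (k - d) * (real d)\<^sup>2 + (real d)\<^sup>2) + (real k)\<^sup>2"
      by (auto simp: Suc_diff_le algebra_simps intro!: sum.cong)
    also have "\<dots> = (\<Sum>d<k. real (k - d) * (real d)\<^sup>2) + (\<Sum>d<k. (real d)\<^sup>2) + (real k)\<^sup>2"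
      by (simp add: sum.distrib)
    finally have "12 * (\<Sum>d<Suc k. real (Suc k - d) * (real d)\<^sup>2)
        = 12 * (\<Sum>d<k. real (k - d) * (real d)\<^sup>2) + 2 * (6 * (\<Sum>d<k. (real d)\<^sup>2)) + 12 * (real k)\<^sup>2" by simp
    with Suc sq[of k] have "12 * (\<Sum>d<Suc k. real (Suc k - d) * (real d)\<^sup>2) + (real (Suc k))\<^sup>2
        = real k ^ 4 - (real k)\<^sup>2 + 2 * ((real k - 1) * real k * (2 * real k - 1)) + 12 * (real k)\<^sup>2 + (real (Suc k))\<^sup>2"
      by linarith
    also have "\<dots> = real (Suc k) ^ 4" by (simp add: power2_eq_square power4_eq_xxxx algebra_simps)
    finally show ?case .
  qed simp
  moreover have "real (\<Sum>(d, e)\<in>{(d, e). d + e < k}. d\<^sup>2) = (\<Sum>d<k. real (k - d) * (real d)\<^sup>2)"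
  proof -
    have "{(d, e). d + e < k} = (SIGMA d:{..<k}. {..<k - d})" by auto
    then show ?thesis by (simp add: sum.Sigma[symmetric])
  qed
  ultimately have "real (12 * (\<Sum>(d, e)\<in>{(d, e). d + e < k}. d\<^sup>2) + k\<^sup>2) = real (k ^ 4)" by simp
  then show ?thesis by (simp only: of_nat_eq_iff)
qed

text \<open>The edges with nonzero defect split into three families, each injecting into the triangle
  \<open>d + e < k\<close> with the defect as first coordinate.\<close>

lemma sum_defect_le:
  "(\<Sum>(i, j)\<in>pairs (2 * k). (defect k i j)\<^sup>2) \<le> 3 * (\<Sum>(d, e)\<in>{(d, e). d + e < k}. d\<^sup>2)"
proof -
  let ?W = "{(d, e). d + e < k}"
  have finW: "finite ?W" by (rule finite_subset[of _ "{..<k} \<times> {..<k}"]) auto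
  have part: "(\<Sum>(i, j)\<in>A. (defect k i j)\<^sup>2) \<le> (\<Sum>(d, e)\<in>?W. d\<^sup>2)"
    if "inj_on f A" "\<And>i j. (i, j) \<in> A \<Longrightarrow> f (i, j) \<in> ?W \<and> fst (f (i, j)) = defect k i j" for f A
  proof -
    have "(\<Sum>(i, j)\<in>A. (defect k i j)\<^sup>2) = (\<Sum>p\<in>A. (fst (f p))\<^sup>2)"
      using that(2) by (intro sum.cong) auto
    also have "\<dots> = (\<Sum>q\<in>f ` A. (fst q)\<^sup>2)" by (simp add: sum.reindex[OF that(1)])
    also have "\<dots> \<le> (\<Sum>q\<in>?W. (fst q)\<^sup>2)"
    proof (rule sum_mono2[OF finW])
      show "f ` A \<subseteq> ?W" using that(2) by force
    qed simp
    finally show ?thesis by (simp add: case_prod_unfold)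
  qed
  define A where "A = {(i, j). (i, j) \<in> pairs (2 * k) \<and> (i + j < k \<or> 3 * k \<le> i + j)}"
  define B where "B = {(i, j). (i, j) \<in> pairs (2 * k) \<and> k \<le> i + j \<and> i + j < 2 * k \<and> k \<le> j}"
  define D where "D = {(i, j). (i, j) \<in> pairs (2 * k) \<and> 2 * k \<le> i + j \<and> i + j < 3 * k \<and> i \<le> k}"
  have fin: "finite A" "finite B" "finite D"
    unfolding A_def B_def D_def by (auto intro: finite_subset[OF _ finite_pairs[of "2 * k"]])
  have "(\<Sum>(i, j)\<in>pairs (2 * k). (defect k i j)\<^sup>2) = (\<Sum>(i, j)\<in>A \<union> (B \<union> D). (defect k i j)\<^sup>2)"
    by (rule sum.mono_neutral_right) (auto simp: A_def B_def D_def defect_def split: if_splits)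
  also have "\<dots> = (\<Sum>(i, j)\<in>A. (defect k i j)\<^sup>2) + ((\<Sum>(i, j)\<in>B. (defect k i j)\<^sup>2) + (\<Sum>(i, j)\<in>D. (defect k i j)\<^sup>2))"
    using fin by (subst sum.union_disjoint; (subst sum.union_disjoint)?) (auto simp: A_def B_def D_def)
  also have "(\<Sum>(i, j)\<in>A. (defect k i j)\<^sup>2) \<le> (\<Sum>(d, e)\<in>?W. d\<^sup>2)"
  \<comment> \<open>Both halves of \<open>A\<close> have defect \<open>j - i\<close>; the parity of
    the second coordinate keeps them apart. The coordinates add up to \<open>i + j\<close> in one
    half and to \<open>4 * k - 1 - (i + j)\<close> in the other, both below
    \<open>k\<close>.\<close>
  proof (rule part[of "\<lambda>(i, j). (j - i, if i + j < k then 2 * i else 2 * (2 * k - 1 - j) + 1)"])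
    show "inj_on (\<lambda>(i, j). (j - i, if i + j < k then 2 * i else 2 * (2 * k - 1 - j) + 1)) A"
    proof (rule inj_onI, clarify)
      fix i j i' j'
      assume ij: "(i, j) \<in> A" "(i', j') \<in> A" and d: "j - i = j' - i'"
        and e: "(if i + j < k then 2 * i else 2 * (2 * k - 1 - j) + 1) = (if i' + j' < k then 2 * i' else 2 * (2 * k - 1 - j') + 1)"
      have "even (2 * i)" "odd (2 * (2 * k - 1 - j) + 1)" for i j by auto
      then have "i + j < k \<longleftrightarrow> i' + j' < k" using e by metis
      then show "i = i' \<and> j = j'" using ij d e by (auto simp: A_def pairs_def split: if_splits)
    qed
  qed (auto simp: A_def pairs_def defect_def)
  also have "(\<Sum>(i, j)\<in>B. (defect k i j)\<^sup>2) \<le> (\<Sum>(d, e)\<in>?W. d\<^sup>2)"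
    by (rule part[of "\<lambda>(i, j). (j - k, i)"]) (auto simp: inj_on_def B_def pairs_def defect_def)
  also have "(\<Sum>(i, j)\<in>D. (defect k i j)\<^sup>2) \<le> (\<Sum>(d, e)\<in>?W. d\<^sup>2)"
    by (rule part[of "\<lambda>(i, j). (k - i, 2 * k - 1 - j)"]) (auto simp: inj_on_def D_def pairs_def defect_def)
  finally show ?thesis by simp
qed

lemma mono_quads_zigzag: "real (card (mono_quads (zigzag (q + 1)) (2 * q + 2))) \<le> Z (2 * q + 2)"
proof -
  define k where "k = q + 1"
  define n where "n = 2 * k"
  define S where "S = real (card (separations (zigzag k) n))"
  define M where "M = real (card (mono_quads (zigzag k) n))"
  define P where "P = real (card (pairs n))"
  define Q where "Q = real (card (quads n))"
  define T where "T = real (\<Sum>(d, e)\<in>{(d, e). d + e < k}. d\<^sup>2)"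
  have "card (separations (zigzag k) n) + (\<Sum>(i, j)\<in>pairs n. (defect k i j)\<^sup>2) = (\<Sum>(i, j)\<in>pairs n. (k - 1)\<^sup>2)"
    unfolding card_separations sum.distrib[symmetric] case_prod_unfold
    by (intro sum.cong refl) (auto simp: n_def pairs_def sides_zigzag)
  then have "(\<Sum>(i, j)\<in>pairs n. (k - 1)\<^sup>2) \<le> card (separations (zigzag k) n) + 3 * (\<Sum>(d, e)\<in>{(d, e). d + e < k}. d\<^sup>2)"
    using sum_defect_le[of k] unfolding n_def by linarith
  then have "card (pairs n) * q\<^sup>2 \<le> card (separations (zigzag k) n) + 3 * (\<Sum>(d, e)\<in>{(d, e). d + e < k}. d\<^sup>2)"
    by (simp add: k_def)
  then have "real (card (pairs n) * q\<^sup>2) \<le> real (card (separations (zigzag k) n) + 3 * (\<Sum>(d, e)\<in>{(d, e). d + e < k}. d\<^sup>2))"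
    by (rule of_nat_mono)
  then have 1: "P * (real q)\<^sup>2 \<le> S + 3 * T" by (simp add: P_def S_def T_def)
  have 2: "S + M = 3 * Q" unfolding S_def M_def Q_def using card_separations_quads[of "zigzag k" n] by linarith
  have 3: "24 * Q = (2 * real q + 2) * (2 * real q + 1) * (2 * real q) * (2 * real q - 1)"
    unfolding Q_def card_quads n_def k_def by (simp add: algebra_simps)
  have 4: "2 * P = (2 * real q + 2) * (2 * real q + 1)"
    unfolding P_def real_card_pairs n_def k_def by (simp add: ac_simps)
  have 5: "12 * T + (real q + 1)\<^sup>2 = (real q + 1) ^ 4"
    using arg_cong[OF sum_triangle_squares[of k], of real] by (simp add: T_def k_def add.commute)
  have "4 * M \<le> 12 * Q - 4 * (P * (real q)\<^sup>2) + 12 * T" using 1 2 by linarith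
  also have "12 * T = (real q + 1) ^ 4 - (real q + 1)\<^sup>2" using 5 by linarith
  also have "12 * Q = (2 * real q + 2) * (2 * real q + 1) * (2 * real q) * (2 * real q - 1) / 2" using 3 by linarith
  also have "4 * (P * (real q)\<^sup>2) = 2 * (2 * P) * (real q)\<^sup>2" by simp
  also have "2 * P = (2 * real q + 2) * (2 * real q + 1)" by (rule 4)
  finally have "4 * M \<le> (real q + 1) * (real q)\<^sup>2 * (real q - 1)"
    by (simp add: field_simps power2_eq_square power4_eq_xxxx)
  moreover have "M = real (card (mono_quads (zigzag (q + 1)) (2 * q + 2)))" by (simp add: M_def n_def k_def)
  ultimately show ?thesis unfolding Z_even by simp
qed

section \<open>Odd orders by deleting a vertex\<close>

definition skip :: "nat \<Rightarrow> nat \<Rightarrow> nat" where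
  "skip v i = (if i < v then i else Suc i)"

lemma skip_less_iff: "skip v i < skip v j \<longleftrightarrow> i < j"
  by (auto simp: skip_def)

lemma card_mono_quads_skip:
  assumes "v \<le> n"
  shows "card (mono_quads (\<lambda>i j. C (skip v i) (skip v j)) n)
    = card {(a, b, c, d) \<in> mono_quads C (Suc n). v \<notin> {a, b, c, d}}"
proof (rule bij_betw_same_card)
  let ?f = "\<lambda>(a, b, c, d). (skip v a, skip v b, skip v c, skip v d)"
  have ran: "\<exists>i. a = skip v i" if "a \<noteq> v" for a
    using that by (intro exI[of _ "if a < v then a else a - 1"]) (auto simp: skip_def)
  have inj: "skip v a = skip v b \<longleftrightarrow> a = b" for a b by (auto simp: skip_def)
  have lt: "skip v d < Suc n \<longleftrightarrow> d < n" for d using assms by (auto simp: skip_def)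
  have ne: "skip v a \<noteq> v" "v \<noteq> skip v a" for a by (auto simp: skip_def)
  show "bij_betw ?f (mono_quads (\<lambda>i j. C (skip v i) (skip v j)) n) {(a, b, c, d) \<in> mono_quads C (Suc n). v \<notin> {a, b, c, d}}"
    unfolding bij_betw_def
  proof (intro conjI equalityI subsetI)
    show "inj_on ?f (mono_quads (\<lambda>i j. C (skip v i) (skip v j)) n)" by (auto simp: inj_on_def inj)
  next
    fix p assume "p \<in> ?f ` mono_quads (\<lambda>i j. C (skip v i) (skip v j)) n"
    then show "p \<in> {(a, b, c, d) \<in> mono_quads C (Suc n). v \<notin> {a, b, c, d}}"
      by (auto simp: mono_quads_def skip_less_iff lt ne)
  next
    fix p assume p: "p \<in> {(a, b, c, d) \<in> mono_quads C (Suc n). v \<notin> {a, b, c, d}}"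
    obtain a b c d where p': "p = (a, b, c, d)" by (cases p)
    have "a \<noteq> v" "b \<noteq> v" "c \<noteq> v" "d \<noteq> v" using p by (auto simp: p')
    with ran[of a] ran[of b] ran[of c] ran[of d] obtain a' b' c' d'
      where eq: "a = skip v a'" "b = skip v b'" "c = skip v c'" "d = skip v d'" by auto
    have "(a', b', c', d') \<in> mono_quads (\<lambda>i j. C (skip v i) (skip v j)) n"
      using p by (auto simp: p' eq mono_quads_def skip_less_iff lt)
    then show "p \<in> ?f ` mono_quads (\<lambda>i j. C (skip v i) (skip v j)) n"
      by (rule rev_image_eqI) (simp add: p' eq)
  qed
qed

text \<open>Averaging: each quadruple survives \<open>n - 3\<close> of the \<open>n + 1\<close>
  possible deletions, so some deletion leaves at most that share.\<close>

lemma ex_vertex_deletion: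
  assumes "n \<ge> 3"
  shows "\<exists>v. real (n + 1) * real (card (mono_quads (\<lambda>i j. C (skip v i) (skip v j)) n))
    \<le> real (n - 3) * real (card (mono_quads C (Suc n)))"
proof -
  define f where "f v = card (mono_quads (\<lambda>i j. C (skip v i) (skip v j)) n)" for v
  let ?M = "mono_quads C (Suc n)"
  have "(\<Sum>v\<le>n. f v) = (\<Sum>v\<le>n. \<Sum>q\<in>?M. if (case q of (a, b, c, d) \<Rightarrow> v \<notin> {a, b, c, d}) then 1 else 0)"
  proof (intro sum.cong refl)
    fix v assume "v \<in> {..n}"
    then have "f v = card {q \<in> ?M. case q of (a, b, c, d) \<Rightarrow> v \<notin> {a, b, c, d}}"
      by (simp add: f_def card_mono_quads_skip case_prod_unfold)
    then show "f v = (\<Sum>q\<in>?M. if (case q of (a, b, c, d) \<Rightarrow> v \<notin> {a, b, c, d}) then 1 else 0)"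
      by (simp only: card_filter_eq_sum[OF finite_mono_quads])
  qed
  also have "\<dots> = (\<Sum>q\<in>?M. \<Sum>v\<le>n. if (case q of (a, b, c, d) \<Rightarrow> v \<notin> {a, b, c, d}) then 1 else 0)"
    by (rule sum.swap)
  also have "\<dots> = (\<Sum>q\<in>?M. n - 3)"
  proof (intro sum.cong refl)
    fix q assume q: "q \<in> ?M"
    obtain a b c d where q': "q = (a, b, c, d)" by (cases q)
    have "(\<Sum>v\<le>n. if (case q of (a, b, c, d) \<Rightarrow> v \<notin> {a, b, c, d}) then 1 else 0) = card ({..n} - {a, b, c, d})"
      by (simp add: sum.If_cases q' set_diff_eq Int_def)
    also have "\<dots> = card {..n} - card {a, b, c, d}"
      using q by (intro card_Diff_subset) (auto simp: q' mono_quads_def)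
    also have "card {a, b, c, d} = 4" using q by (auto simp: q' mono_quads_def)
    finally show "(\<Sum>v\<le>n. if (case q of (a, b, c, d) \<Rightarrow> v \<notin> {a, b, c, d}) then 1 else 0) = n - 3" by simp
  qed
  finally have sum: "(\<Sum>v\<le>n. f v) = card ?M * (n - 3)" by simp
  show ?thesis
  proof (rule ccontr)
    assume "\<not> ?thesis"
    then have gt: "real (n - 3) * real (card ?M) < real (n + 1) * real (f v)" for v
      by (simp add: f_def not_le)
    have "real (n + 1) * (real (n - 3) * real (card ?M)) = (\<Sum>v\<le>n. real (n - 3) * real (card ?M))" by simp
    also have "\<dots> < (\<Sum>v\<le>n. real (n + 1) * real (f v))" by (rule sum_strict_mono) (use gt in auto)
    also have "\<dots> = real (n + 1) * real (\<Sum>v\<le>n. f v)" by (simp add: sum_distrib_left)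
    finally show False unfolding sum by (simp add: ac_simps)
  qed
qed

lemma ex_mono_quads_le: "\<exists>C. real (card (mono_quads C n)) \<le> Z n"
proof (cases n rule: nat_parity_cases)
  case 1
  then have "mono_quads C n = {}" for C by (auto simp: mono_quads_def)
  then show ?thesis using 1 by (simp add: Z_le_1)
next
  case (2 q)
  then show ?thesis using mono_quads_zigzag by blast
next
  case (3 q)
  \<comment> \<open>\<open>Suc n = 2 * (q + 2)\<close>, so this is the even colouring on one vertex
    more.\<close>
  let ?C = "zigzag (q + 2)"
  obtain v where v: "real (n + 1) * real (card (mono_quads (\<lambda>i j. ?C (skip v i) (skip v j)) n))
    \<le> real (n - 3) * real (card (mono_quads ?C (Suc n)))"
    using ex_vertex_deletion[of n ?C] 3 by auto
  have "real (card (mono_quads ?C (Suc n))) \<le> (real q + 2) * (real q + 1)\<^sup>2 * real q / 4"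
    using mono_quads_zigzag[of "q + 1"] Z_even[of "q + 1"] by (simp add: 3 numeral_eq_Suc ac_simps)
  then have "2 * real q * real (card (mono_quads ?C (Suc n)))
      \<le> 2 * real q * ((real q + 2) * (real q + 1)\<^sup>2 * real q / 4)"
    by (intro mult_left_mono) auto
  \<comment> \<open>Averaging loses nothing here: \<open>(n - 3) * Z (n + 1) = (n + 1) * Z n\<close>
    for odd \<open>n\<close>.\<close>
  also have "\<dots> = (2 * real q + 4) * Z n" unfolding 3 Z_odd by (simp add: power2_eq_square algebra_simps)
  finally have "(2 * real q + 4) * real (card (mono_quads (\<lambda>i j. ?C (skip v i) (skip v j)) n)) \<le> (2 * real q + 4) * Z n"
    using v by (simp add: 3 algebra_simps)
  then have "real (card (mono_quads (\<lambda>i j. ?C (skip v i) (skip v j)) n)) \<le> Z n"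
    by (subst (asm) mult_le_cancel_left_pos) auto
  then show ?thesis by blast
qed

section \<open>Crossings forced by interleaving\<close>

text \<open>The inner product with \<open>a\<close> turned by a right angle, hence a coordinate
  along the spine, scaled by the length of \<open>a\<close>.\<close>

definition spine_coord :: "real^2 \<Rightarrow> real^2 \<Rightarrow> real" where
  "spine_coord a x = a $ 2 * x $ 1 - a $ 1 * x $ 2"

definition straighten :: "real^2 \<Rightarrow> real \<Rightarrow> real^2 \<Rightarrow> real^2" where
  "straighten a b x = spine_coord a x *\<^sub>R axis 1 1 + (a \<bullet> x - b) *\<^sub>R axis 2 1"

lemma straighten_nth [simp]:
  "straighten a b x $ 1 = spine_coord a x" "straighten a b x $ 2 = a \<bullet> x - b"
  by (simp_all add: straighten_def axis_def)

lemma spine_coord_eqD: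
  assumes "a \<noteq> 0" "spine_coord a x = spine_coord a y" "a \<bullet> x = a \<bullet> y"
  shows "x = y"
proof -
  have nz: "(a $ 1)\<^sup>2 + (a $ 2)\<^sup>2 \<noteq> 0"
    using assms(1) by (auto simp: vec_eq_iff forall_2 sum_power2_eq_zero_iff)
  have 1: "a $ 2 * x $ 1 - a $ 1 * x $ 2 = a $ 2 * y $ 1 - a $ 1 * y $ 2"
    using assms(2) by (simp add: spine_coord_def)
  have 2: "a $ 1 * x $ 1 + a $ 2 * x $ 2 = a $ 1 * y $ 1 + a $ 2 * y $ 2"
    using assms(3) by (simp add: inner_vec_def sum_2)
  have "((a $ 1)\<^sup>2 + (a $ 2)\<^sup>2) * (x $ 1 - y $ 1) = 0" "((a $ 1)\<^sup>2 + (a $ 2)\<^sup>2) * (x $ 2 - y $ 2) = 0"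
    using 1 2 by algebra+
  then have "x $ 1 - y $ 1 = 0" "x $ 2 - y $ 2 = 0" using nz unfolding mult_eq_0_iff by blast+
  then show ?thesis by (simp add: vec_eq_iff forall_2)
qed

lemma continuous_on_straighten: "continuous_on S (straighten a b)"
  unfolding straighten_def spine_coord_def by (intro continuous_intros)

text \<open>Straightening puts both curves into a box whose bottom edge lies on the image of the
  spine and carries the four interleaved ends, the situation of \<open>fashoda_interlace\<close>.
  Injectivity brings the common point back.\<close>

lemma arcs_meet_ordered:
  fixes f g :: "real \<Rightarrow> real^2"
  assumes a: "a \<noteq> 0" and f: "path f" and g: "path g"
    and f_sub: "path_image f \<subseteq> {x. b \<le> a \<bullet> x}" and g_sub: "path_image g \<subseteq> {x. b \<le> a \<bullet> x}"
    and ends: "a \<bullet> pathstart f = b" "a \<bullet> pathfinish f = b" "a \<bullet> pathstart g = b" "a \<bullet> pathfinish g = b"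
    and ord: "spine_coord a (pathstart f) < spine_coord a (pathstart g)"
      "spine_coord a (pathstart g) < spine_coord a (pathfinish f)"
      "spine_coord a (pathfinish f) < spine_coord a (pathfinish g)"
  shows "path_image f \<inter> path_image g \<noteq> {}"
proof -
  let ?T = "straighten a b"
  have paths: "path (?T \<circ> f)" "path (?T \<circ> g)"
    by (intro path_continuous_image f g continuous_on_straighten)+
  have "bounded (path_image (?T \<circ> f) \<union> path_image (?T \<circ> g))"
    using paths by (simp add: bounded_path_image)
  then obtain M where M: "\<And>z. z \<in> path_image (?T \<circ> f) \<union> path_image (?T \<circ> g) \<Longrightarrow> norm z \<le> M"
    unfolding bounded_iff by blast
  have box: "z \<in> cbox (vector [- M, 0]) (vector [M, M])"
    if "z \<in> path_image (?T \<circ> f) \<union> path_image (?T \<circ> g)" for z :: "real^2"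
  proof -
    have "\<bar>z $ 1\<bar> \<le> M" "\<bar>z $ 2\<bar> \<le> M"
      using M[OF that] component_le_norm_cart order_trans by blast+
    moreover have "0 \<le> z $ 2"
      using that f_sub g_sub by (auto simp: path_image_compose)
    ultimately show ?thesis by (auto simp: mem_box_cart forall_2)
  qed
  obtain z where "z \<in> path_image (?T \<circ> f)" "z \<in> path_image (?T \<circ> g)"
    by (rule fashoda_interlace[OF paths, of "vector [- M, 0]" "vector [M, M]"])
      (use box ends ord in \<open>auto simp: pathstart_compose pathfinish_compose\<close>)
  then obtain x y where "x \<in> path_image f" "y \<in> path_image g" "?T x = ?T y"
    by (auto simp: path_image_compose)
  moreover from this have "x = y"
    using spine_coord_eqD[OF a, of x y] by (metis straighten_nth diff_add_cancel)
  ultimately show ?thesis by blast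
qed

text \<open>A drawing fixes the ends of a curve only as a set, so each curve is reversed where
  necessary.\<close>

lemma arcs_meet_upper:
  fixes f g :: "real \<Rightarrow> real^2"
  assumes a: "a \<noteq> 0" and f: "path f" and g: "path g"
    and f_sub: "path_image f \<subseteq> {x. b \<le> a \<bullet> x}" and g_sub: "path_image g \<subseteq> {x. b \<le> a \<bullet> x}"
    and ends: "{pathstart f, pathfinish f} = {P, R}" "{pathstart g, pathfinish g} = {Q, S}"
    and line: "a \<bullet> P = b" "a \<bullet> Q = b" "a \<bullet> R = b" "a \<bullet> S = b"
    and ord: "spine_coord a P < spine_coord a Q" "spine_coord a Q < spine_coord a R" "spine_coord a R < spine_coord a S"
  shows "path_image f \<inter> path_image g \<noteq> {}"
proof -
  define f' where "f' = (if pathstart f = P then f else reversepath f)"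
  define g' where "g' = (if pathstart g = Q then g else reversepath g)"
  have f': "path f'" "path_image f' = path_image f" "pathstart f' = P" "pathfinish f' = R"
    using f ends(1) by (auto simp: f'_def doubleton_eq_iff)
  have g': "path g'" "path_image g' = path_image g" "pathstart g' = Q" "pathfinish g' = S"
    using g ends(2) by (auto simp: g'_def doubleton_eq_iff)
  show ?thesis
    using arcs_meet_ordered[OF a f'(1) g'(1), of b] f_sub g_sub line ord by (simp add: f' g')
qed

text \<open>For the lower half-plane \<open>a\<close> and \<open>b\<close> are negated. This also
  reverses the order along the spine to \<open>S, R, Q, P\<close>, so \<open>f\<close> and
  \<open>g\<close> exchange roles.\<close>

lemma arcs_meet:
  fixes f g :: "real \<Rightarrow> real^2"
  assumes a: "a \<noteq> 0" and f: "path f" and g: "path g"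
    and sub: "path_image f \<union> path_image g \<subseteq> {x. b \<le> a \<bullet> x} \<or> path_image f \<union> path_image g \<subseteq> {x. a \<bullet> x \<le> b}"
    and ends: "{pathstart f, pathfinish f} = {P, R}" "{pathstart g, pathfinish g} = {Q, S}"
    and line: "a \<bullet> P = b" "a \<bullet> Q = b" "a \<bullet> R = b" "a \<bullet> S = b"
    and ord: "spine_coord a P < spine_coord a Q" "spine_coord a Q < spine_coord a R" "spine_coord a R < spine_coord a S"
  shows "path_image f \<inter> path_image g \<noteq> {}"
  using sub
proof
  assume "path_image f \<union> path_image g \<subseteq> {x. b \<le> a \<bullet> x}"
  then show ?thesis using arcs_meet_upper[OF a f g _ _ ends line ord] by blast
next
  assume "path_image f \<union> path_image g \<subseteq> {x. a \<bullet> x \<le> b}"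
  moreover have "spine_coord (- a) x = - spine_coord a x" for x by (simp add: spine_coord_def)
  ultimately have "path_image g \<inter> path_image f \<noteq> {}"
    using a line ord ends
    by (intro arcs_meet_upper[of "- a" g f "- b" S Q R P] f g) auto
  then show ?thesis by blast
qed

section \<open>From a drawing to a colouring\<close>

lemma two_page_drawing_edge:
  assumes D: "two_page_drawing G a b p \<gamma>" and e: "e \<in> edges G" and eV: "e \<subseteq> verts G"
  defines "up \<equiv> \<gamma> e ` {0<..<1} \<subseteq> {x. b < a \<bullet> x}"
  shows "path (\<gamma> e)" "{pathstart (\<gamma> e), pathfinish (\<gamma> e)} = p ` e"
    "up \<Longrightarrow> path_image (\<gamma> e) \<subseteq> {x. b \<le> a \<bullet> x}"
    "\<not> up \<Longrightarrow> path_image (\<gamma> e) \<subseteq> {x. a \<bullet> x \<le> b}"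
    "\<And>x. x \<in> path_image (\<gamma> e) \<Longrightarrow> a \<bullet> x = b \<Longrightarrow> x \<in> p ` e"
proof -
  have arc: "arc (\<gamma> e)" and ends: "{pathstart (\<gamma> e), pathfinish (\<gamma> e)} = p ` e"
    and half: "\<gamma> e ` {0<..<1} \<subseteq> {x. a \<bullet> x < b} \<or> up"
    using D e by (auto simp: two_page_drawing_def up_def)
  show "path (\<gamma> e)" using arc by (rule arc_imp_path)
  show "{pathstart (\<gamma> e), pathfinish (\<gamma> e)} = p ` e" by (rule ends)
  have "{0..1::real} = {0, 1} \<union> {0<..<1}" by auto
  then have "path_image (\<gamma> e) = p ` e \<union> \<gamma> e ` {0<..<1}"
    unfolding path_image_def ends[symmetric] pathstart_def pathfinish_def by auto
  moreover have "a \<bullet> x = b" if "x \<in> p ` e" for x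
    using that D eV by (auto simp: two_page_drawing_def)
  ultimately show "up \<Longrightarrow> path_image (\<gamma> e) \<subseteq> {x. b \<le> a \<bullet> x}"
    "\<not> up \<Longrightarrow> path_image (\<gamma> e) \<subseteq> {x. a \<bullet> x \<le> b}"
    "\<And>x. x \<in> path_image (\<gamma> e) \<Longrightarrow> a \<bullet> x = b \<Longrightarrow> x \<in> p ` e"
    using half by (fastforce simp: up_def)+
qed

lemma sorted_enumeration:
  fixes h :: "nat \<Rightarrow> real"
  assumes "inj_on h {..<n}"
  obtains u where "bij_betw u {..<n} {..<n}" "\<And>i j. i < j \<Longrightarrow> j < n \<Longrightarrow> h (u i) < h (u j)"
proof -
  define xs where "xs = sorted_list_of_set (h ` {..<n})"
  define g where "g i = xs ! i" for i
  have len: "length xs = n" using assms by (simp add: xs_def card_image)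
  have "bij_betw (\<lambda>i. xs ! i) {..<n} (h ` {..<n})"
    by (rule bij_betw_nth) (auto simp: xs_def card_image[OF assms])
  then have g: "bij_betw g {..<n} (h ` {..<n})" by (simp add: g_def[abs_def])
  have g_less: "g i < g j" if "i < j" "j < n" for i j
    unfolding g_def using that len strict_sorted_list_of_set[of "h ` {..<n}"]
    by (intro sorted_wrt_nth_less[of "(<)"]) (auto simp: xs_def)
  let ?u = "\<lambda>i. inv_into {..<n} h (g i)"
  have "bij_betw (inv_into {..<n} h) (h ` {..<n}) {..<n}"
    using assms by (intro bij_betw_inv_into) (simp add: bij_betw_def)
  from bij_betw_trans[OF g this] have "bij_betw ?u {..<n} {..<n}" by (simp add: o_def)
  moreover have "h (?u i) = g i" if "i < n" for i
    using g that by (intro f_inv_into_f) (auto simp: bij_betw_def)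
  then have "h (?u i) < h (?u j)" if "i < j" "j < n" for i j
    using g_less[OF that] that by simp
  ultimately show thesis by (rule that)
qed

text \<open>Vertices are renumbered along the spine and edges coloured by half-plane. Distinct
  monochromatic quadruples give distinct crossing pairs of edges; \<open>fst\<close> forgets the
  points, since a pair may meet several times.\<close>

lemma mono_quads_le_crossings:
  assumes D: "two_page_drawing (complete_graph n) a b p \<gamma>"
    and fin: "finite (crossings (complete_graph n) p \<gamma>)"
  shows "\<exists>C. card (mono_quads C n) \<le> card (crossings (complete_graph n) p \<gamma>)"
proof -
  let ?G = "complete_graph n"
  have V: "verts ?G = {..<n}" by (simp add: complete_graph_def)
  have a: "a \<noteq> 0" and injp: "inj_on p {..<n}" and line: "\<And>v. v < n \<Longrightarrow> a \<bullet> p v = b"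
    using D by (auto simp: two_page_drawing_def V)
  have "inj_on (\<lambda>v. spine_coord a (p v)) {..<n}"
    using spine_coord_eqD[OF a] line injp by (auto simp: inj_on_def)
  then obtain u where u: "bij_betw u {..<n} {..<n}"
    and mono: "\<And>i j. i < j \<Longrightarrow> j < n \<Longrightarrow> spine_coord a (p (u i)) < spine_coord a (p (u j))"
    by (rule sorted_enumeration) auto
  have uinj: "inj_on u {..<n}" and uless: "\<And>i. i < n \<Longrightarrow> u i < n"
    using u by (auto simp: bij_betw_def)
  define C where "C i j \<longleftrightarrow> \<gamma> {u i, u j} ` {0<..<1} \<subseteq> {x. b < a \<bullet> x}" for i j
  define F where "F = (\<lambda>(i, j, k, l). {{u i, u k}, {u j, u l}})"
  have "F q \<in> fst ` crossings ?G p \<gamma>" if "q \<in> mono_quads C n" for q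
  proof -
    obtain i j k l where q: "q = (i, j, k, l)" by (cases q)
    have ord: "i < j" "j < k" "k < l" "l < n" and same: "C i k = C j l"
      using that by (auto simp: q mono_quads_def)
    let ?e = "{u i, u k}" and ?f = "{u j, u l}"
    have neq: "u i \<noteq> u j" "u i \<noteq> u k" "u i \<noteq> u l" "u j \<noteq> u k" "u j \<noteq> u l" "u k \<noteq> u l"
      using ord inj_onD[OF uinj] by fastforce+
    have lt: "u i < n" "u j < n" "u k < n" "u l < n" using ord uless by auto
    have e: "?e \<in> edges ?G" "?f \<in> edges ?G" and eV: "?e \<subseteq> verts ?G" "?f \<subseteq> verts ?G"
      using neq lt by (auto simp: complete_graph_def)
    note E = two_page_drawing_edge[OF D e(1) eV(1)] and F = two_page_drawing_edge[OF D e(2) eV(2)]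
    have "path_image (\<gamma> ?e) \<union> path_image (\<gamma> ?f) \<subseteq> {x. b \<le> a \<bullet> x}
      \<or> path_image (\<gamma> ?e) \<union> path_image (\<gamma> ?f) \<subseteq> {x. a \<bullet> x \<le> b}"
      using Un_least[OF E(3) F(3)] Un_least[OF E(4) F(4)] same unfolding C_def by argo
    then have "path_image (\<gamma> ?e) \<inter> path_image (\<gamma> ?f) \<noteq> {}"
      by (rule arcs_meet[OF a E(1) F(1) _ E(2)[unfolded image_insert image_empty] F(2)[unfolded image_insert image_empty]])
        (use ord mono[of i j] mono[of j k] mono[of k l] line lt in simp_all)
    then obtain x where x: "x \<in> path_image (\<gamma> ?e)" "x \<in> path_image (\<gamma> ?f)" by blast
    \<comment> \<open>A vertex lies on the spine, which each curve meets only at its ends; the two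
      edges have no end in common.\<close>
    have "x \<notin> p ` verts ?G"
    proof
      assume "x \<in> p ` verts ?G"
      then have "a \<bullet> x = b" using line by (auto simp: V)
      then have "x \<in> p ` ?e" "x \<in> p ` ?f" using E(5) F(5) x by auto
      then obtain v w where vw: "v \<in> ?e" "w \<in> ?f" "p v = p w" by force
      then have "v < n" "w < n" using lt by auto
      then have "v = w" using vw(3) injp by (auto dest: inj_onD)
      then show False using vw(1,2) neq by auto
    qed
    moreover have "?e \<noteq> ?f" using neq by (auto simp: doubleton_eq_iff)
    ultimately have "({?e, ?f}, x) \<in> crossings ?G p \<gamma>"
      using x e unfolding crossings_def by blast
    then have "fst ({?e, ?f}, x) \<in> fst ` crossings ?G p \<gamma>" by (rule imageI)
    then show ?thesis by (simp add: F_def q)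
  qed
  then have sub: "F ` mono_quads C n \<subseteq> fst ` crossings ?G p \<gamma>" by blast
  have "inj_on F (mono_quads C n)"
  proof (rule inj_onI)
    fix q r assume q: "q \<in> mono_quads C n" and r: "r \<in> mono_quads C n" and eq: "F q = F r"
    define S where "S = (\<lambda>(i, j, k, l). {i, j, k, l :: nat})"
    \<comment> \<open>The union of the two edges recovers the four vertices, and with them the
      sorted quadruple.\<close>
    have US: "\<Union> (F q) = u ` S q" for q
      by (auto simp: F_def S_def split: prod.splits)
    have sub: "S q \<subseteq> {..<n}" if "q \<in> mono_quads C n" for q
      using that by (auto simp: S_def mono_quads_def)
    have "u ` S q = u ` S r" using eq US[of q] US[of r] by simp
    then have "S q = S r" using inj_on_image_eq_iff[OF uinj sub[OF q] sub[OF r]] by blast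
    moreover have "inj_on S (quads n)" unfolding S_def by (rule inj_on_quads)
    ultimately show "q = r" using q r mono_quads_subset[of C n] by (meson inj_onD subsetD)
  qed
  then have "card (mono_quads C n) = card (F ` mono_quads C n)" by (simp add: card_image)
  also have "\<dots> \<le> card (fst ` crossings ?G p \<gamma>)" using fin sub by (intro card_mono) auto
  also have "\<dots> \<le> card (crossings ?G p \<gamma>)" by (rule card_image_le[OF fin])
  finally show ?thesis by blast
qed

section \<open>Drawings with parabolas\<close>

definition pt :: "real \<Rightarrow> real \<Rightarrow> real^2" where
  "pt x y = x *\<^sub>R axis 1 1 + y *\<^sub>R axis 2 1"

lemma pt_nth [simp]: "pt x y $ 1 = x" "pt x y $ 2 = y"
  by (simp_all add: pt_def axis_def)

lemma inner_axis_2: "axis 2 1 \<bullet> x = x $ 2" for x :: "real^2"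
  by (simp add: inner_axis')

text \<open>Edges are drawn as the parabolas \<open>y = \<plusminus> (x - i) (j - x)\<close> rather than as semicircles: two of
  them meet where a linear function of \<open>x\<close> vanishes.\<close>

definition parabola :: "(nat \<Rightarrow> nat \<Rightarrow> bool) \<Rightarrow> nat set \<Rightarrow> real \<Rightarrow> real^2" where
  "parabola C e t = (let i = Min e; j = Max e; x = real i + (real j - real i) * t in
     pt x ((if C i j then 1 else - 1) * ((x - real i) * (real j - x))))"

lemma parabola_pair:
  assumes "i < j"
  shows "parabola C {i, j} t = (let x = real i + (real j - real i) * t in
     pt x ((if C i j then 1 else - 1) * ((x - real i) * (real j - x))))"
  using assms by (simp add: parabola_def min_def max_def)

lemma path_image_parabola:
  assumes "i < j" "z \<in> path_image (parabola C {i, j})"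
  shows "real i \<le> z $ 1" "z $ 1 \<le> real j"
    "z $ 2 = (if C i j then 1 else - 1) * ((z $ 1 - real i) * (real j - z $ 1))"
proof -
  obtain t where t: "0 \<le> t" "t \<le> 1" "z = parabola C {i, j} t"
    using assms(2) by (auto simp: path_image_def)
  have "0 \<le> (real j - real i) * t" "(real j - real i) * t \<le> real j - real i"
    using t assms(1) by (auto intro: mult_left_le)
  then show "real i \<le> z $ 1" "z $ 1 \<le> real j"
    "z $ 2 = (if C i j then 1 else - 1) * ((z $ 1 - real i) * (real j - z $ 1))"
    by (auto simp: t(3) parabola_pair[OF assms(1)] Let_def)
qed

lemma complete_graph_edgeE:
  assumes "e \<in> edges (complete_graph n)"
  obtains i j where "i < j" "j < n" "e = {i, j}"
proof -
  obtain x y where "e = {x, y}" "x \<noteq> y" "x < n" "y < n"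
    using assms by (auto simp: complete_graph_def card_2_iff)
  then show thesis
    using that[of x y] that[of y x] by (cases "x < y") (auto simp: insert_commute)
qed

lemma two_page_drawing_parabola:
  "two_page_drawing (complete_graph n) (axis 2 1) 0 (\<lambda>v. pt (real v) 0) (parabola C)"
  unfolding two_page_drawing_def
proof (intro conjI ballI)
  show "axis 2 1 \<noteq> (0 :: real^2)" by (simp add: axis_eq_0_iff)
  show "inj_on (\<lambda>v. pt (real v) 0) (verts (complete_graph n))"
    by (rule inj_onI) (metis pt_nth(1) of_nat_eq_iff)
  show "axis 2 1 \<bullet> pt (real v) 0 = 0" for v by (simp add: inner_axis_2)
next
  fix e assume "e \<in> edges (complete_graph n)"
  then obtain i j where ij: "i < j" "j < n" "e = {i, j}" by (rule complete_graph_edgeE)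
  note eq = parabola_pair[OF ij(1), of C, folded ij(3)]
  have "continuous_on {0..1} (\<lambda>t. parabola C e t)"
    unfolding eq Let_def pt_def by (intro continuous_intros)
  moreover have "inj_on (parabola C e) {0..1}"
  proof (rule inj_onI)
    fix s t assume "parabola C e s = parabola C e t"
    then have "parabola C e s $ 1 = parabola C e t $ 1" by simp
    then show "s = t" using ij(1) by (simp add: eq Let_def)
  qed
  ultimately show "arc (parabola C e)" by (simp add: arc_def path_def)
  show "{pathstart (parabola C e), pathfinish (parabola C e)} = (\<lambda>v. pt (real v) 0) ` e"
    unfolding pathstart_def pathfinish_def eq by (simp add: ij(3) Let_def)
  have pos: "0 < (real i + (real j - real i) * t - real i) * (real j - (real i + (real j - real i) * t))"
    if "0 < t" "t < 1" for t
  proof -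
    have "real j - (real i + (real j - real i) * t) = (real j - real i) * (1 - t)" by (simp add: algebra_simps)
    then show ?thesis using that ij(1) by simp
  qed
  show "parabola C e ` {0<..<1} \<subseteq> {x. axis 2 1 \<bullet> x < 0} \<or> parabola C e ` {0<..<1} \<subseteq> {x. 0 < axis 2 1 \<bullet> x}"
  proof (cases "C i j")
    case True
    then show ?thesis using pos by (intro disjI2) (auto simp: eq Let_def inner_axis_2)
  next
    case False
    then show ?thesis using pos by (intro disjI1) (auto simp: eq Let_def inner_axis_2)
  qed
qed

text \<open>The abscissa \<open>x\<close> is the root of the linear equation
  \<open>(x - a) * (c - x) = (x - b) * (d - x)\<close>.\<close>

definition crossing_of :: "(nat \<Rightarrow> nat \<Rightarrow> bool) \<Rightarrow> nat \<times> nat \<times> nat \<times> nat \<Rightarrow> nat set set \<times> (real^2)" where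
  "crossing_of C = (\<lambda>(a, b, c, d).
     let x = (real b * real d - real a * real c) / (real b + real d - real a - real c)
     in ({{a, c}, {b, d}}, pt x ((if C a c then 1 else - 1) * ((x - real a) * (real c - x)))))"

text \<open>Off the spine a common point forces equal colours. Equal left ends would force equal
  right ends, and for nested intervals the outer parabola is strictly farther from the spine, so the
  ends interleave.\<close>

lemma parabola_crossing:
  assumes ij: "i < j" "j < n" and kl: "k < l" "l < n" and ne: "{i, j} \<noteq> {k, l}" and ik: "i \<le> k"
    and z: "z \<in> path_image (parabola C {i, j})" "z \<in> path_image (parabola C {k, l})"
    and nv: "z \<notin> (\<lambda>v. pt (real v) 0) ` {..<n}"
  shows "(i, k, j, l) \<in> mono_quads C n" "({{i, j}, {k, l}}, z) = crossing_of C (i, k, j, l)"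
proof -
  define x where "x = z $ 1"
  note E = path_image_parabola[OF ij(1) z(1), folded x_def] and F = path_image_parabola[OF kl(1) z(2), folded x_def]
  have zeq: "z = pt x (z $ 2)" by (simp add: x_def vec_eq_iff forall_2)
  have nat: "False" if "x = real v" "z $ 2 = 0" "v < n" for v using that nv zeq by auto
  have strict: "real i < x" "x < real j" "real k < x" "x < real l"
    using nat[of i] nat[of j] nat[of k] nat[of l] E F ij kl by (auto simp: less_le)
  have pos: "0 < (x - real i) * (real j - x)" "0 < (x - real k) * (real l - x)"
    using strict by simp_all
  have same: "C i j = C k l"
    using E(3) F(3) pos by (auto split: if_splits)
  then have eq: "(x - real i) * (real j - x) = (x - real k) * (real l - x)"
    using E(3) F(3) by (auto split: if_splits)
  have "i \<noteq> k"
  proof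
    assume "i = k"
    then have "real j - x = real l - x" using eq strict by simp
    then show False using ne \<open>i = k\<close> by simp
  qed
  then have ik': "i < k" using ik by simp
  have "real k < real j" using strict by linarith
  then have kj: "k < j" by simp
  have jl: "j < l"
  proof (rule ccontr)
    assume "\<not> j < l"
    then have "(x - real k) * (real l - x) \<le> (x - real k) * (real j - x)"
      using strict by (intro mult_left_mono) auto
    also have "\<dots> < (x - real i) * (real j - x)"
      using strict ik' by (intro mult_strict_right_mono) auto
    finally show False using eq by simp
  qed
  show "(i, k, j, l) \<in> mono_quads C n"
    using ik' kj jl kl same by (simp add: mono_quads_def)
  have "x * (real k + real l - real i - real j) = real k * real l - real i * real j"
    using eq by (simp add: algebra_simps)
  moreover have "real k + real l - real i - real j > 0" using ik' jl by linarith
  ultimately have "x = (real k * real l - real i * real j) / (real k + real l - real i - real j)"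
    by (simp add: field_simps)
  moreover have "z = pt x ((if C i j then 1 else - 1) * ((x - real i) * (real j - x)))"
    using zeq E(3) by simp
  ultimately show "({{i, j}, {k, l}}, z) = crossing_of C (i, k, j, l)"
    by (simp add: crossing_of_def Let_def)
qed

lemma crossings_parabola:
  "crossings (complete_graph n) (\<lambda>v. pt (real v) 0) (parabola C) \<subseteq> crossing_of C ` mono_quads C n"
proof
  fix c assume "c \<in> crossings (complete_graph n) (\<lambda>v. pt (real v) 0) (parabola C)"
  then obtain e f z where c: "c = ({e, f}, z)" and ef: "e \<in> edges (complete_graph n)" "f \<in> edges (complete_graph n)" "e \<noteq> f"
    and z: "z \<in> path_image (parabola C e)" "z \<in> path_image (parabola C f)" "z \<notin> (\<lambda>v. pt (real v) 0) ` {..<n}"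
    by (auto simp: crossings_def complete_graph_def)
  obtain i j where ij: "i < j" "j < n" "e = {i, j}" using ef(1) by (rule complete_graph_edgeE)
  obtain k l where kl: "k < l" "l < n" "f = {k, l}" using ef(2) by (rule complete_graph_edgeE)
  show "c \<in> crossing_of C ` mono_quads C n"
  proof (cases "i \<le> k")
    case True
    note * = parabola_crossing[OF ij(1,2) kl(1,2) _ True _ _ z(3), of C, folded ij(3) kl(3), OF ef(3) z(1,2)]
    from *(1) show ?thesis by (rule rev_image_eqI) (simp add: c *(2))
  next
    case False
    then have "k \<le> i" by simp
    note * = parabola_crossing[OF kl(1,2) ij(1,2) _ this _ _ z(3), of C, folded ij(3) kl(3), OF ef(3)[symmetric] z(2,1)]
    from *(1) show ?thesis by (rule rev_image_eqI) (simp add: c *(2)[symmetric] insert_commute)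
  qed
qed

section \<open>The crossing number and its ratio to \<open>Z\<close>\<close>

lemma two_page_crossing_number_complete_graph:
  "real (two_page_crossing_number (complete_graph n)) = Z n"
proof (rule antisym)
  let ?P = "\<lambda>k. \<exists>a b p \<gamma>. two_page_drawing (complete_graph n) a b p \<gamma> \<and>
        finite (crossings (complete_graph n) p \<gamma>) \<and> card (crossings (complete_graph n) p \<gamma>) = k"
  obtain C where C: "real (card (mono_quads C n)) \<le> Z n" using ex_mono_quads_le by blast
  let ?X = "crossings (complete_graph n) (\<lambda>v. pt (real v) 0) (parabola C)"
  have fin: "finite ?X" by (rule finite_subset[OF crossings_parabola]) simp
  have "card ?X \<le> card (crossing_of C ` mono_quads C n)" by (rule card_mono[OF _ crossings_parabola]) simp
  also have "\<dots> \<le> card (mono_quads C n)" by (rule card_image_le) simp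
  finally have le: "card ?X \<le> card (mono_quads C n)" .
  have P: "?P (card ?X)" using two_page_drawing_parabola fin by blast
  then have "two_page_crossing_number (complete_graph n) \<le> card ?X"
    unfolding two_page_crossing_number_def by (rule Least_le)
  with le C show "real (two_page_crossing_number (complete_graph n)) \<le> Z n" by linarith
  \<comment> \<open>The parabolas also show that some drawing has finitely many crossings, so the
    least value is attained.\<close>
  from P have "?P (two_page_crossing_number (complete_graph n))"
    unfolding two_page_crossing_number_def by (rule LeastI)
  then obtain C where "card (mono_quads C n) \<le> two_page_crossing_number (complete_graph n)"
    using mono_quads_le_crossings by metis
  with mono_quads_ge[of n C] show "Z n \<le> real (two_page_crossing_number (complete_graph n))" by linarith
qed

lemma Z_pos:
  assumes "n \<ge> 5"
  shows "Z n > 0"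
proof (cases n rule: nat_parity_cases)
  case (2 q)
  then have "real q > 1" using assms by simp
  then show ?thesis unfolding 2 Z_even by simp
next
  case (3 q)
  then have "real q > 0" using assms by simp
  then show ?thesis unfolding 3 Z_odd by simp
qed (use assms in simp)

theorem theorem1:
  shows "(\<forall>m::nat. (1 \<le> m \<and> m \<le> 18) \<or> m \<in> {20, 24} \<longrightarrow>
            real (two_page_crossing_number (complete_graph m)) = Z m)
       \<and> (\<exists>L::real. (\<lambda>n::nat. real (two_page_crossing_number (complete_graph n)) / Z n) \<longlonglongrightarrow> L
            \<and> L \<ge> 0.9253)"
proof (intro conjI exI)
  \<comment> \<open>The limit is 1. The quotient is considered from \<open>n = 5\<close> on, since
    \<open>Z\<close> vanishes below.\<close>
  have "eventually (\<lambda>n. 1 = real (two_page_crossing_number (complete_graph n)) / Z n) sequentially"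
    using eventually_ge_at_top[of 5]
    by eventually_elim (use Z_pos in \<open>force simp: two_page_crossing_number_complete_graph\<close>)
  then show "(\<lambda>n. real (two_page_crossing_number (complete_graph n)) / Z n) \<longlonglongrightarrow> 1"
    by (rule Lim_transform_eventually[OF tendsto_const])
qed (simp_all add: two_page_crossing_number_complete_graph)

end
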